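(* Let $\mathcal{H}$ be a real Hilbert space, let $A:\mathcal{H}\rightrightarrows\mathcal{H}$ be a maximally monotone operator, let $\beta>0$ and let $B:\mathcal{H}\to\mathcal{H}$ be $\beta$-cocoercive such that $\operatorname{zer}(A+B)\neq\emptyset$. Let $\gamma\in(0,2\beta)$ and set $\delta=\min\{1,\beta/\gamma\}+1/2$. Let $\lambda:[0,+\infty)\to[0,\delta]$ be a Lebesgue measurable function and $x_0\in\mathcal{H}$. Suppose that one of the following conditions is fulfilled: $$\int_0^{+\infty}\lambda(t)(\delta-\lambda(t))\,dt=+\infty\quad\text{or}\quad\inf_{t\ge0}\lambda(t)>0.$$ Let $x:[0,+\infty)\to\mathcal{H}$ be the unique strong global solution of $$\dot x(t)=\lambda(t)\Big[J_{\gamma A}\big(x(t)-\gamma B(x(t))\big)-x(t)\Big],\qquad x(0)=x_0.$$ Then the following statements are true: (i) the trajectory $x$ is bounded and $\int_0^{+\infty}\|\dot x(t)\|^2\,dt<+\infty$; (ii) $\lim_{t\to+\infty}\Big[J_{\gamma A}\big(x(t)-\gamma B(x(t))\big)-x(t)\Big]=0$ (strongly); (iii) $\lim_{t\to+\infty}\dot x(t)=0$ (strongly); (iv) $x(t)$ converges weakly to a point in $\operatorname{zer}(A+B)$, as $t\to+\infty$. Suppose, in addition, that $\inf_{t\ge0}\lambda(t)>0$. Then the following hold: (v) if $y\in\operatorname{zer}(A+B)$, then $\lim_{t\to+\infty}B(x(t))=By$ (strongly), and $B$ is constant on $\operatorname{zer}(A+B)$; (vi) if $A$ or $B$ is uniformly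 monotone, then $x(t)$ converges strongly to the unique point in $\operatorname{zer}(A+B)$, as $t\to+\infty$.
   Context: For a set-valued operator $A:\mathcal{H}\rightrightarrows\mathcal{H}$, its graph is $\operatorname{Gr}A=\{(x,u)\in\mathcal{H}\times\mathcal{H}:u\in Ax\}$ and $\operatorname{zer}A=\{x\in\mathcal{H}:0\in Ax\}$. $A$ is monotone if $\langle x-y,u-v\rangle\ge0$ for all $(x,u),(y,v)\in\operatorname{Gr}A$, and maximally monotone if moreover there is no proper monotone extension of its graph in $\mathcal{H}\times\mathcal{H}$. For maximally monotone $A$ and $\gamma>0$, the resolvent $J_{\gamma A}=(\operatorname{Id}+\gamma A)^{-1}:\mathcal{H}\to\mathcal{H}$ is single-valued and everywhere defined. $A$ is uniformly monotone if there exists an increasing function $\phi_A:[0,+\infty)\to[0,+\infty]$ that vanishes only at $0$ such that $\langle x-y,u-v\rangle\ge\phi_A(\|x-y\|)$ for all $(x,u),(y,v)\in\operatorname{Gr}A$ (single-valued operators are identified with set-valued ones, so this also applies to $B$). $B:\mathcal{H}\to\mathcal{H}$ is $\beta$-cocoercive if $\langle x-y,Bx-By\rangle\ge\beta\|Bx-By\|^2$ for all $x,y\in\mathcal{H}$. A strong global solution of the system is a function $x:[0,+\infty)\to\mathcal{H}$ which is absolutely continuous on each interval $[0,b]$, $0<b<+\infty$ (i.e. on $[0,b]$ it is the sum of a constant and the indefinite integral of an integrable $\mathcal{H}$-valued function), satisfies the differential equation for almost all $t\ge0$, and satisfies $x(0)=x_0$. Such a solution exists and is unique. The derivative $\dot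 x(t)$ exists for almost all $t\ge 0$; statements about $\dot x(t)$ are understood for those $t$ at which the derivative exists. *)

theory Defs
  imports "HOL-Analysis.Analysis"
begin

section \<open>Set-valued operators\<close>

type_synonym 'a set_operator = "'a \<Rightarrow> 'a set"

definition op_graph :: "'a set_operator \<Rightarrow> ('a \<times> 'a) set" where
  "op_graph A = {(x, u). u \<in> A x}"

definition op_zer :: "'a::zero set_operator \<Rightarrow> 'a set" where
  "op_zer A = {x. 0 \<in> A x}"

definition op_of_fun :: "('a \<Rightarrow> 'a) \<Rightarrow> 'a set_operator" where
  "op_of_fun B = (\<lambda>x. {B x})"

definition op_add :: "'a::plus set_operator \<Rightarrow> 'a set_operator \<Rightarrow> 'a set_operator" where
  "op_add A B = (\<lambda>x. {u + v | u v. u \<in> A x \<and> v \<in> B x})"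

definition op_scaleR :: "real \<Rightarrow> 'a::real_vector set_operator \<Rightarrow> 'a set_operator" where
  "op_scaleR c A = (\<lambda>x. {c *\<^sub>R u | u. u \<in> A x})"

definition op_inverse :: "'a set_operator \<Rightarrow> 'a set_operator" where
  "op_inverse A = (\<lambda>y. {x. y \<in> A x})"

(* (Id + A)^{-1} as a point-valued map. It is meaningful where the inverse is single-valued,
   hence everywhere when A is maximally monotone on a Hilbert space. *)
definition resolvent :: "'a::monoid_add set_operator \<Rightarrow> 'a \<Rightarrow> 'a" where
  "resolvent A y = (THE p. p \<in> op_inverse (op_add (op_of_fun id) A) y)"

definition monotone_op :: "'a::real_inner set_operator \<Rightarrow> bool" where
  "monotone_op A \<longleftrightarrow>
     (\<forall>(x, u) \<in> op_graph A. \<forall>(y, v) \<in> op_graph A. inner (x - y) (u - v) \<ge> 0)"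

definition maximally_monotone_op :: "'a::real_inner set_operator \<Rightarrow> bool" where
  "maximally_monotone_op A \<longleftrightarrow>
     monotone_op A \<and> (\<nexists>A'. monotone_op A' \<and> op_graph A \<subset> op_graph A')"

(* "Increasing" is understood in the non-strict sense. *)
definition uniformly_monotone_op :: "'a::real_inner set_operator \<Rightarrow> bool" where
  "uniformly_monotone_op A \<longleftrightarrow>
     (\<exists>\<phi> :: real \<Rightarrow> ereal.
        (\<forall>t\<ge>0. \<phi> t \<ge> 0) \<and> mono_on {0..} \<phi> \<and> (\<forall>t\<ge>0. \<phi> t = 0 \<longleftrightarrow> t = 0) \<and>
        (\<forall>(x, u) \<in> op_graph A. \<forall>(y, v) \<in> op_graph A.
           ereal (inner (x - y) (u - v)) \<ge> \<phi> (norm (x - y))))"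

definition cocoercive :: "real \<Rightarrow> ('a::real_inner \<Rightarrow> 'a) \<Rightarrow> bool" where
  "cocoercive \<beta> B \<longleftrightarrow> (\<forall>x y. inner (x - y) (B x - B y) \<ge> \<beta> * (norm (B x - B y))\<^sup>2)"


section \<open>Weak convergence\<close>

(* Continuous linear functionals are represented by the inner product (Riesz). *)
definition weakly_tendsto :: "('b \<Rightarrow> 'a::real_inner) \<Rightarrow> 'a \<Rightarrow> 'b filter \<Rightarrow> bool" where
  "weakly_tendsto f l F \<longleftrightarrow> (\<forall>z. ((\<lambda>t. inner (f t) z) \<longlongrightarrow> inner l z) F)"


section \<open>Bochner integrals in possibly non-separable spaces\<close>

(* The library's has_bochner_integral requires a second-countable range. This is its definition
   without that restriction. The functions s i are integrable simple functions, so f is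
   essentially separably valued, as Bochner integrability demands. *)
definition has_bochner_integral_nonsep ::
    "'a measure \<Rightarrow> ('a \<Rightarrow> 'b::real_normed_vector) \<Rightarrow> 'b \<Rightarrow> bool" where
  "has_bochner_integral_nonsep M f I \<longleftrightarrow>
     f \<in> borel_measurable M \<and>
     (\<exists>s :: nat \<Rightarrow> 'a \<Rightarrow> 'b.
        (\<forall>i. Bochner_Integration.simple_bochner_integrable M (s i)) \<and>
        (\<lambda>i. \<integral>\<^sup>+t. norm (f t - s i t) \<partial>M) \<longlonglongrightarrow> 0 \<and>
        (\<lambda>i. Bochner_Integration.simple_bochner_integral M (s i)) \<longlonglongrightarrow> I)"

lemma has_bochner_integral_nonsep_iff:
  fixes f :: "'a \<Rightarrow> 'b::{real_normed_vector, second_countable_topology}"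
  shows "has_bochner_integral_nonsep M f I \<longleftrightarrow> has_bochner_integral M f I"
  unfolding has_bochner_integral_nonsep_def has_bochner_integral.simps by auto


section \<open>Strong global solutions\<close>

(* Integrability of g on {0..b} is the instance t = b. *)
definition locally_absolutely_continuous :: "(real \<Rightarrow> 'a::real_normed_vector) \<Rightarrow> bool" where
  "locally_absolutely_continuous x \<longleftrightarrow>
     (\<forall>b>0. \<exists>c g. \<forall>t\<in>{0..b}. has_bochner_integral_nonsep (lebesgue_on {0..t}) g (x t - c))"

(* Functions on the half-line are total functions on the reals; only their values on {0..} matter,
   so derivatives are taken within {0..}. *)
definition strong_global_solution ::
    "(real \<Rightarrow> 'a \<Rightarrow> 'a) \<Rightarrow> 'a \<Rightarrow> (real \<Rightarrow> 'a::real_normed_vector) \<Rightarrow> bool" where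
  "strong_global_solution F x0 x \<longleftrightarrow>
     locally_absolutely_continuous x \<and>
     (AE t in lebesgue_on {0..}. (x has_vector_derivative F t (x t)) (at t within {0..})) \<and>
     x 0 = x0"

end

theory Submission
  imports Defs
begin

text \<open>
  Put \<open>T z = J (z - \<gamma> B z)\<close> with \<open>J\<close> the resolvent of \<open>\<gamma> A\<close>. All that is needed about
  \<open>T\<close> is that it is nonexpansive with fixed points \<open>zer (A + B)\<close>, and all that is needed about \<open>\<lambda>\<close> is that
  it is bounded with infinite integral. Along \<open>x' = \<lambda> (T x - x)\<close> the distance to every fixed point and the
  residual \<open>\<bar>T x - x\<bar>\<close> are nonincreasing, and \<open>\<integral> \<lambda> \<bar>T x - x\<bar>\<^sup>2 \<le> \<bar>x(0) - y\<bar>\<^sup>2\<close> for every fixed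
  point \<open>y\<close>; so the residual tends to 0, and Opial's lemma with demiclosedness of \<open>T - id\<close> gives weak
  convergence. Strong convergence of \<open>B x\<close>, and of \<open>x\<close> under uniform monotonicity, follows by
  comparing the graph point of \<open>A\<close> over \<open>T x\<close> with the point \<open>(y, - B y)\<close>.

  Since \<open>T\<close> and \<open>x\<close> take values in a possibly non-separable space, the monotonicity statements are derived
  from a comparison principle for upper right Dini derivatives rather than by differentiating compositions.
\<close>

section \<open>Quadratic minimisation, the Riesz representation and Minty's theorem\<close>

text \<open>The resolvent is given by a definite description, so even the nonexpansiveness of
  \<open>T\<close> presupposes that \<open>Id + \<gamma> A\<close> is onto. This is Minty's theorem,
  obtained by minimising a convex function plus a squared norm. The same minimisation yields the
  Riesz representation, by which weak cluster points become vectors. The equation holds only almost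
  everywhere, and a continuous function can grow although its Dini derivatives are nonpositive off a
  null set. Absolute continuity excludes this by bounding the increments of \<open>x\<close> by
  integrals of a real function \<open>k\<close>; from then on only real functions are integrated.
  The relaxation \<open>lam\<close> may exceed 1, since \<delta> lies between 1 and 3/2. In a
  discrete iteration the term quadratic in the relaxation would enter the estimates. In continuous
  time it carries the square of the time step and vanishes: a sufficiently short Euler step from
  \<open>x\<close> is a convex combination of \<open>x\<close> and \<open>T x\<close>. No uniform
  step length is required, since a Dini derivative looks only at times just to the right of a given
  one.\<close>

lemma regularized_minimum:
  fixes E :: "('b::{real_inner, complete_space} \<times> real) set"
  assumes cl: "closed E" and cv: "convex E" and ne: "E \<noteq> {}"
    and bdd: "\<And>z r. (z, r) \<in> E \<Longrightarrow> m0 \<le> r + (norm z)\<^sup>2 / 2"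
  shows "\<exists>(z, r) \<in> E. \<forall>(w, s) \<in> E. r + (norm z)\<^sup>2 \<le> s + inner z w"
proof -
  define q where "q = (\<lambda>p::'b\<times>real. snd p + (norm (fst p))\<^sup>2 / 2)"
  define m where "m = Inf (q ` E)"
  have bb: "bdd_below (q ` E)"
    unfolding q_def by (rule bdd_belowI[of _ m0]) (auto intro: bdd)
  have m_le: "m \<le> q p" if "p \<in> E" for p
    unfolding m_def using bb that by (auto intro: cInf_lower)
  have "\<exists>p\<in>E. q p < m + 1 / real (Suc n)" for n
  proof -
    have "Inf (q ` E) < m + 1 / real (Suc n)" by (simp add: m_def)
    then show ?thesis using cInf_less_iff[OF _ bb] ne by auto
  qed
  then obtain P where P: "\<And>n. P n \<in> E" "\<And>n. q (P n) < m + 1 / real (Suc n)" by metis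
  \<comment> \<open>Parallelogram identity at the midpoint: the strongly convex term of
    \<open>q\<close> makes the vector components of a minimising sequence Cauchy. The real
    components converge because \<open>q\<close> does.\<close>
  have dist_le: "(norm (fst u - fst v))\<^sup>2 \<le> 4 * (q u - m) + 4 * (q v - m)" if "u \<in> E" "v \<in> E" for u v
  proof -
    have "(1/2) *\<^sub>R u + (1/2) *\<^sub>R v \<in> E"
      using cv that by (auto simp: convex_def)
    then have "m \<le> q ((1/2) *\<^sub>R u + (1/2) *\<^sub>R v)" by (rule m_le)
    also have "\<dots> = (q u + q v) / 2 - (norm (fst u - fst v))\<^sup>2 / 8"
      unfolding q_def
      by (simp add: power2_norm_eq_inner inner_add_left inner_add_right inner_diff_left
          inner_diff_right inner_commute diff_divide_distrib add_divide_distrib algebra_simps)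
    finally show ?thesis by (simp add: field_simps)
  qed
  have "Cauchy (\<lambda>n. fst (P n))"
  proof (rule metric_CauchyI)
    fix e :: real assume e: "e > 0"
    then obtain N where N: "inverse (real (Suc N)) < e\<^sup>2 / 8"
      using reals_Archimedean[of "e\<^sup>2 / 8"] by auto
    have "dist (fst (P i)) (fst (P j)) < e" if "i \<ge> N" "j \<ge> N" for i j
    proof -
      have *: "q (P k) - m < e\<^sup>2 / 8" if "k \<ge> N" for k
      proof -
        have "1 / real (Suc k) \<le> inverse (real (Suc N))"
          using that by (simp add: field_simps)
        with P(2)[of k] N show ?thesis by linarith
      qed
      have "(norm (fst (P i) - fst (P j)))\<^sup>2 < e\<^sup>2"
        using dist_le[OF P(1) P(1), of i j] *[OF that(1)] *[OF that(2)] by argo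
      then show ?thesis using e by (simp add: dist_norm power_less_imp_less_base)
    qed
    then show "\<exists>M. \<forall>m\<ge>M. \<forall>n\<ge>M. dist (fst (P m)) (fst (P n)) < e" by blast
  qed
  then obtain z where z: "(\<lambda>n. fst (P n)) \<longlonglongrightarrow> z"
    using Cauchy_convergent convergent_def by blast
  have qlim: "(\<lambda>n. q (P n)) \<longlonglongrightarrow> m"
  proof (rule tendsto_sandwich[of "\<lambda>_. m"])
    show "(\<lambda>n. m + 1 / real (Suc n)) \<longlonglongrightarrow> m"
      using tendsto_add[OF tendsto_const[of m] LIMSEQ_inverse_real_of_nat] by (simp add: inverse_eq_divide)
    show "\<forall>\<^sub>F n in sequentially. m \<le> q (P n)" "\<forall>\<^sub>F n in sequentially. q (P n) \<le> m + 1 / real (Suc n)"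
      by (intro always_eventually allI m_le P(1) less_imp_le[OF P(2)])+
  qed simp
  define r where "r = m - (norm z)\<^sup>2 / 2"
  have "(\<lambda>n. q (P n) - (norm (fst (P n)))\<^sup>2 / 2) \<longlonglongrightarrow> r"
    unfolding r_def by (intro tendsto_intros qlim z) auto
  then have "(\<lambda>n. snd (P n)) \<longlonglongrightarrow> r" by (simp add: q_def)
  with z have "(\<lambda>n. (fst (P n), snd (P n))) \<longlonglongrightarrow> (z, r)" by (rule tendsto_Pair)
  then have zr: "(z, r) \<in> E"
    using cl P(1) by (auto intro: closed_sequentially)
  have "r + (norm z)\<^sup>2 \<le> s + inner z w" if ws: "(w, s) \<in> E" for w s
  proof -
    \<comment> \<open>Minimality is tested on the segment from \<open>(z, r)\<close> to
      \<open>(w, s)\<close>; dividing by \<open>t\<close> and letting it tend to 0 leaves the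
      first-order condition.\<close>
    have ineq: "0 \<le> s - r + inner z (w - z) + t * ((norm (w - z))\<^sup>2 / 2)" if t: "0 < t" "t < 1" for t :: real
    proof -
      have "(1 - t) *\<^sub>R (z, r) + t *\<^sub>R (w, s) \<in> E"
        using cv zr ws t unfolding convex_alt by (meson less_imp_le)
      from m_le[OF this] have "0 \<le> q ((1 - t) *\<^sub>R (z, r) + t *\<^sub>R (w, s)) - m" by simp
      also have "\<dots> = t * (s - r + inner z (w - z) + t * ((norm (w - z))\<^sup>2 / 2))"
        unfolding q_def r_def
        by (simp add: power2_norm_eq_inner inner_add_left inner_add_right inner_diff_left
          inner_diff_right inner_commute diff_divide_distrib add_divide_distrib algebra_simps)
      finally show ?thesis using t by (simp add: zero_le_mult_iff)
    qed
    have "((\<lambda>t. s - r + inner z (w - z) + t * ((norm (w - z))\<^sup>2 / 2)) \<longlongrightarrow>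
        s - r + inner z (w - z) + 0 * ((norm (w - z))\<^sup>2 / 2)) (at_right 0)"
      by (intro tendsto_intros)
    moreover have "\<forall>\<^sub>F t in at_right (0::real). 0 \<le> s - r + inner z (w - z) + t * ((norm (w - z))\<^sup>2 / 2)"
      using eventually_at_right_real[of 0 1] ineq by (auto elim: eventually_mono)
    ultimately have "0 \<le> s - r + inner z (w - z) + 0 * ((norm (w - z))\<^sup>2 / 2)"
      by (rule tendsto_lowerbound) simp
    then show ?thesis by (simp add: inner_diff_right power2_norm_eq_inner)
  qed
  with zr show ?thesis by blast
qed

text \<open>Minimise |z|^2 / 2 - \<phi> z. The optimality condition says that the linear functional
  \<open>inner p w - \<phi> w\<close> is bounded below, and a linear functional bounded below
  vanishes.\<close>

lemma Riesz_representation: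
  fixes \<phi> :: "'a::{real_inner, complete_space} \<Rightarrow> real"
  assumes "bounded_linear \<phi>"
  shows "\<exists>p. \<forall>z. \<phi> z = inner p z"
proof -
  interpret bounded_linear \<phi> by fact
  obtain K where K: "\<And>z. norm (\<phi> z) \<le> norm z * K" using bounded by auto
  define E where "E = {(z, r). r = - \<phi> z}"
  have "closed E"
    unfolding E_def case_prod_unfold
    by (intro closed_Collect_eq continuous_intros continuous_on continuous_on_fst continuous_on_id)
  moreover have "convex E"
    unfolding E_def convex_def by (auto simp: add scale algebra_simps)
  moreover have "E \<noteq> {}" by (auto simp: E_def)
  moreover have "- K\<^sup>2 / 2 \<le> r + (norm z)\<^sup>2 / 2" if "(z, r) \<in> E" for z r
  proof -
    have "0 \<le> (norm z - K)\<^sup>2" by simp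
    then have "norm z * K \<le> (norm z)\<^sup>2 / 2 + K\<^sup>2 / 2"
      by (simp add: power2_diff field_simps)
    with K[of z] that show ?thesis by (auto simp: E_def abs_le_iff)
  qed
  ultimately obtain p r where "(p, r) \<in> E" and p: "\<And>w s. (w, s) \<in> E \<Longrightarrow> r + (norm p)\<^sup>2 \<le> s + inner p w"
    using regularized_minimum[of E] by blast
  define c where "c = r + (norm p)\<^sup>2"
  have lower: "c \<le> inner p w - \<phi> w" for w
    using p[of w "- \<phi> w"] by (auto simp: E_def c_def)
  have "\<phi> w = inner p w" for w
  proof (rule ccontr)
    assume "\<phi> w \<noteq> inner p w"
    then have d: "inner p w - \<phi> w \<noteq> 0" by simp
    define t where "t = (c - 1) / (inner p w - \<phi> w)"
    have "inner p (t *\<^sub>R w) - \<phi> (t *\<^sub>R w) = t * (inner p w - \<phi> w)"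
      by (simp add: scale algebra_simps)
    also have "\<dots> = c - 1" using d by (simp add: t_def)
    finally show False using lower[of "t *\<^sub>R w"] by simp
  qed
  then show ?thesis by blast
qed

section \<open>Maximally monotone operators, Minty's theorem and the resolvent\<close>

lemma maximally_monotoneD:
  assumes "maximally_monotone_op A" and "\<And>a b. b \<in> A a \<Longrightarrow> 0 \<le> inner (x - a) (u - b)"
  shows "u \<in> A x"
proof (rule ccontr)
  assume u: "u \<notin> A x"
  \<comment> \<open>Adjoining the single point \<open>(x, u)\<close> keeps the graph monotone, which
    contradicts maximality.\<close>
  define A' where "A' = A(x := insert u (A x))"
  have "monotone_op A'"
    unfolding monotone_op_def
  proof (clarsimp simp: op_graph_def)
    fix a b a' b' assume "b \<in> A' a" "b' \<in> A' a'"
    then have "(b \<in> A a \<or> (a = x \<and> b = u)) \<and> (b' \<in> A a' \<or> (a' = x \<and> b' = u))"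
      by (auto simp: A'_def split: if_splits)
    moreover have flip: "inner (a - a') (b - b') = inner (a' - a) (b' - b)"
      by (simp add: inner_diff_left inner_diff_right)
    moreover have "0 \<le> inner (a - a') (b - b')" if "b \<in> A a" "b' \<in> A a'"
      using assms(1) that unfolding maximally_monotone_op_def monotone_op_def op_graph_def by blast
    ultimately show "0 \<le> inner (a - a') (b - b')"
      using assms(2)[of b' a'] assms(2)[of b a] by (elim conjE disjE) (simp_all only: flip diff_self inner_zero_left)
  qed
  moreover have "op_graph A \<subset> op_graph A'"
  proof -
    have "(x, u) \<in> op_graph A'" "(x, u) \<notin> op_graph A" using u by (auto simp: op_graph_def A'_def)
    moreover have "op_graph A \<subseteq> op_graph A'" by (auto simp: op_graph_def A'_def)
    ultimately show ?thesis by blast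
  qed
  ultimately show False using assms(1) unfolding maximally_monotone_op_def by blast
qed

text \<open>With an empty graph every point would be monotonically related to it, so
  \<open>(0, 0)\<close> would have to belong to it.\<close>

lemma maximally_monotone_nonempty:
  assumes "maximally_monotone_op A"
  obtains a b where "b \<in> A a"
  using maximally_monotoneD[OF assms, of 0 0] by blast

lemma monotone_opD: "monotone_op A \<Longrightarrow> b \<in> A a \<Longrightarrow> d \<in> A c \<Longrightarrow> 0 \<le> inner (a - c) (b - d)"
  unfolding monotone_op_def op_graph_def by blast

text \<open>
  \<open>E\<close> is the epigraph of the Fitzpatrick function of \<open>A\<close>, which dominates \<open>\<langle>x, u\<rangle>\<close> by maximality.
  The optimality condition at its regularised minimiser \<open>(x, u)\<close> says that \<open>(- u, - x)\<close> is monotonically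
  related to the graph, hence belongs to it; inserting this very point yields \<open>u = - x\<close>.
\<close>

theorem Minty_at_zero:
  fixes A :: "'a::{real_inner, complete_space} set_operator"
  assumes A: "maximally_monotone_op A"
  obtains x where "- x \<in> A x"
proof -
  have mono: "monotone_op A" using A by (simp add: maximally_monotone_op_def)
  define E :: "(('a \<times> 'a) \<times> real) set" where
    "E = (\<Inter>(a, b) \<in> op_graph A. {p. inner (fst p) (b, a) - inner a b \<le> snd p})"
  have E_iff: "((x, u), r) \<in> E \<longleftrightarrow> (\<forall>a b. b \<in> A a \<longrightarrow> inner x b + inner u a - inner a b \<le> r)" for x u r
    by (auto simp: E_def op_graph_def)
  have "closed E"
    unfolding E_def by (intro closed_INT ballI) (auto simp: case_prod_unfold intro!: closed_Collect_le continuous_intros)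
  moreover have "convex E"
    unfolding E_def
  proof (intro convex_INT)
    fix i assume "i \<in> op_graph A"
    have "convex {p::('a \<times> 'a) \<times> real. inner (fst p) (snd i, fst i) - inner (fst i) (snd i) \<le> snd p}"
    proof (rule convexI)
      fix x y :: "('a \<times> 'a) \<times> real" and s t :: real
      assume xy: "x \<in> {p. inner (fst p) (snd i, fst i) - inner (fst i) (snd i) \<le> snd p}" "y \<in> {p. inner (fst p) (snd i, fst i) - inner (fst i) (snd i) \<le> snd p}"
        and st: "0 \<le> s" "0 \<le> t" "s + t = 1"
      have "s * (inner (fst x) (snd i, fst i) - inner (fst i) (snd i)) + t * (inner (fst y) (snd i, fst i) - inner (fst i) (snd i)) \<le> s * snd x + t * snd y"
        using xy st by (intro add_mono mult_left_mono) auto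
      moreover have t: "t = 1 - s" using st by simp
      ultimately show "s *\<^sub>R x + t *\<^sub>R y \<in> {p. inner (fst p) (snd i, fst i) - inner (fst i) (snd i) \<le> snd p}"
        unfolding t by (simp add: inner_add_left algebra_simps)
    qed
    then show "convex (case i of (a, b) \<Rightarrow> {p::('a \<times> 'a) \<times> real. inner (fst p) (b, a) - inner a b \<le> snd p})"
      by (simp add: case_prod_unfold)
  qed
  moreover have "E \<noteq> {}"
  proof -
    obtain a0 b0 where "b0 \<in> A a0" by (rule maximally_monotone_nonempty[OF A])
    then have "((a0, b0), inner a0 b0) \<in> E"
      unfolding E_iff using monotone_opD[OF mono, of b0 a0]
      by (fastforce simp: inner_diff_left inner_diff_right inner_commute algebra_simps)
    then show ?thesis by blast
  qed
  moreover have Fitzpatrick: "inner x u \<le> r" if "((x, u), r) \<in> E" for x u r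
  proof (rule ccontr)
    assume r: "\<not> inner x u \<le> r"
    have "0 \<le> inner (x - a) (u - b)" if "b \<in> A a" for a b
    proof -
      have "inner x b + inner u a - inner a b \<le> r" using \<open>((x, u), r) \<in> E\<close> that by (auto simp: E_iff)
      with r show ?thesis by (simp add: inner_diff_left inner_diff_right inner_commute algebra_simps)
    qed
    then have "u \<in> A x" by (rule maximally_monotoneD[OF A])
    with \<open>((x, u), r) \<in> E\<close> have "inner x u + inner u x - inner x u \<le> r" unfolding E_iff by blast
    with r show False by (simp add: inner_commute)
  qed
  \<comment> \<open>Together with the Fitzpatrick inequality this bounds the regularised objective
    below by 0.\<close>
  have nonneg: "0 \<le> inner x u + ((norm x)\<^sup>2 + (norm u)\<^sup>2) / 2" for x u :: 'a
  proof -
    have "0 \<le> (norm (x + u))\<^sup>2" by simp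
    then show ?thesis by (simp add: power2_norm_eq_inner inner_add_left inner_add_right inner_commute field_simps)
  qed
  have bdd: "0 \<le> r + (norm z)\<^sup>2 / 2" if "(z, r) \<in> E" for z r
    using Fitzpatrick[of "fst z" "snd z" r] nonneg[of "fst z" "snd z"] that
    by (cases z) (simp add: norm_Pair)
  obtain z r where zr: "(z, r) \<in> E" "\<And>w s. (w, s) \<in> E \<Longrightarrow> r + (norm z)\<^sup>2 \<le> s + inner z w"
    using regularized_minimum[OF calculation(1-3) bdd] by blast
  obtain x u where z: "z = (x, u)" by (cases z)
  \<comment> \<open>By monotonicity a graph point gives the element
    \<open>((a, b), inner a b)\<close> of \<open>E\<close>. The optimality condition is tested
    there, \<open>r\<close> is replaced by its lower bound \<open>inner x u\<close>, and the square
    is completed.\<close>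
  have key: "(norm (x + u))\<^sup>2 \<le> inner (a + u) (b + x)" if "b \<in> A a" for a b
  proof -
    have "((a, b), inner a b) \<in> E"
      unfolding E_iff using monotone_opD[OF mono that]
      by (fastforce simp: inner_diff_left inner_diff_right inner_commute algebra_simps)
    from zr(2)[OF this] Fitzpatrick[of x u r] zr(1) show ?thesis
      by (simp add: z norm_Pair power2_norm_eq_inner inner_add_left inner_add_right inner_commute)
  qed
  have "- x \<in> A (- u)"
  proof (rule maximally_monotoneD[OF A])
    fix a b assume "b \<in> A a"
    have "0 \<le> (norm (x + u))\<^sup>2" by simp
    also have "\<dots> \<le> inner (a + u) (b + x)" by (rule key[OF \<open>b \<in> A a\<close>])
    also have "\<dots> = inner (- u - a) (- x - b)"
      by (simp add: inner_diff_left inner_diff_right inner_add_left inner_add_right)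
    finally show "0 \<le> inner (- u - a) (- x - b)" .
  qed
  moreover from key[OF this] have "u = - x"
    by (simp add: eq_neg_iff_add_eq_0 add.commute)
  ultimately show thesis using that[of x] by simp
qed

text \<open>The shifted operator \<gamma> A - y is again maximally monotone, and a point
  \<open>p\<close> with \<open>- p\<close> among its values at \<open>p\<close> is a solution. Two
  solutions differ by a multiple of \<open>v - u\<close>, to which monotonicity gives the wrong sign
  unless it is zero.\<close>

theorem Minty:
  fixes A :: "'a::{real_inner, complete_space} set_operator"
  assumes A: "maximally_monotone_op A" and \<gamma>: "0 < \<gamma>"
  shows "\<exists>!p. \<exists>u \<in> A p. y = p + \<gamma> *\<^sub>R u"
proof (rule ex_ex1I)
  have mono: "monotone_op A" using A by (simp add: maximally_monotone_op_def)
  define A' where "A' = (\<lambda>x. {\<gamma> *\<^sub>R u - y | u. u \<in> A x})"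
  have "maximally_monotone_op A'"
    unfolding maximally_monotone_op_def
  proof (intro conjI notI)
    show "monotone_op A'"
      unfolding monotone_op_def op_graph_def A'_def
    proof (clarsimp)
      fix a c b d assume "b \<in> A a" "d \<in> A c"
      then have "0 \<le> \<gamma> * inner (a - c) (b - d)" using monotone_opD[OF mono] \<gamma> by auto
      then show "0 \<le> inner (a - c) (\<gamma> *\<^sub>R b - \<gamma> *\<^sub>R d)"
        by (simp add: inner_diff_right algebra_simps)
    qed
  next
    assume "\<exists>C. monotone_op C \<and> op_graph A' \<subset> op_graph C"
    then obtain C x v where C: "monotone_op C" "op_graph A' \<subset> op_graph C" and xv: "v \<in> C x" "v \<notin> A' x"
      unfolding op_graph_def by blast
    define u where "u = (1 / \<gamma>) *\<^sub>R (v + y)"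
    have v: "v = \<gamma> *\<^sub>R u - y" using \<gamma> by (simp add: u_def)
    have "u \<in> A x"
    proof (rule maximally_monotoneD[OF A])
      fix a b assume "b \<in> A a"
      then have "\<gamma> *\<^sub>R b - y \<in> A' a" by (auto simp: A'_def)
      then have "\<gamma> *\<^sub>R b - y \<in> C a" using C(2) by (auto simp: op_graph_def)
      from monotone_opD[OF C(1) xv(1) this] have "0 \<le> \<gamma> * inner (x - a) (u - b)"
        by (simp add: v inner_diff_right algebra_simps)
      then show "0 \<le> inner (x - a) (u - b)" using \<gamma> by (simp add: zero_le_mult_iff)
    qed
    with xv(2) v show False by (auto simp: A'_def)
  qed
  then obtain p where "- p \<in> A' p" by (rule Minty_at_zero)
  then show "\<exists>p. \<exists>u \<in> A p. y = p + \<gamma> *\<^sub>R u"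
    by (auto simp: A'_def algebra_simps intro!: exI[of _ p])
next
  have mono: "monotone_op A" using A by (simp add: maximally_monotone_op_def)
  fix p q assume "\<exists>u \<in> A p. y = p + \<gamma> *\<^sub>R u" "\<exists>u \<in> A q. y = q + \<gamma> *\<^sub>R u"
  then obtain u v where uv: "u \<in> A p" "v \<in> A q" "y = p + \<gamma> *\<^sub>R u" "y = q + \<gamma> *\<^sub>R v" by blast
  have pq: "p - q = \<gamma> *\<^sub>R (v - u)" using uv(3,4) by (simp add: algebra_simps)
  have "0 \<le> inner (p - q) (u - v)" by (rule monotone_opD[OF mono uv(1,2)])
  also have "\<dots> = - (\<gamma> * (norm (v - u))\<^sup>2)"
    by (simp add: pq power2_norm_eq_inner inner_diff_left inner_diff_right inner_commute algebra_simps)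
  finally have "norm (v - u) = 0" using \<gamma> by (simp add: mult_le_0_iff)
  then show "p = q" using pq by simp
qed

text \<open>Minty's theorem legitimises the \<open>THE\<close> in \<open>resolvent\<close>; from
  here on the resolvent is handled only through membership in \<open>A\<close>.\<close>

lemma resolvent_eq_iff:
  fixes A :: "'a::{real_inner, complete_space} set_operator"
  assumes A: "maximally_monotone_op A" and \<gamma>: "0 < \<gamma>"
  shows "resolvent (op_scaleR \<gamma> A) y = p \<longleftrightarrow> (1 / \<gamma>) *\<^sub>R (y - p) \<in> A p"
proof -
  have "(p \<in> op_inverse (op_add (op_of_fun id) (op_scaleR \<gamma> A)) y) = (\<exists>u \<in> A p. y = p + \<gamma> *\<^sub>R u)" for p
    by (auto simp: op_inverse_def op_add_def op_of_fun_def op_scaleR_def)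
  then have eq: "resolvent (op_scaleR \<gamma> A) y = (THE p. \<exists>u \<in> A p. y = p + \<gamma> *\<^sub>R u)"
    by (simp add: resolvent_def)
  have "(resolvent (op_scaleR \<gamma> A) y = p) = (\<exists>u \<in> A p. y = p + \<gamma> *\<^sub>R u)"
    unfolding eq using theI'[OF Minty[OF A \<gamma>, of y]] the1_equality[OF Minty[OF A \<gamma>, of y], of p]
    by blast
  also have "\<dots> \<longleftrightarrow> (1 / \<gamma>) *\<^sub>R (y - p) \<in> A p"
  proof
    assume "(1 / \<gamma>) *\<^sub>R (y - p) \<in> A p"
    then show "\<exists>u \<in> A p. y = p + \<gamma> *\<^sub>R u" using \<gamma> by (intro bexI) auto
  qed (use \<gamma> in auto)
  finally show ?thesis .
qed

section \<open>Weak limits along filters\<close>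

text \<open>
  Tychonoff's theorem gives a cluster point of the functionals \<open>\<langle>x t, \<cdot>\<rangle>\<close> in the product topology; no
  separability is needed when filters replace subsequences.
\<close>

lemma weakly_convergent_subfilter:
  fixes x :: "'b \<Rightarrow> 'a::{real_inner, complete_space}"
  assumes F: "F \<noteq> bot" and bdd: "\<forall>\<^sub>F t in F. norm (x t) \<le> M"
  obtains G p where "G \<le> F" "G \<noteq> bot" "weakly_tendsto x p G"
proof -
  define ev where "ev = (\<lambda>t z. inner (x t) z)"
  define K where "K = PiE UNIV (\<lambda>z::'a. {- (M * norm z)..M * norm z})"
  have "compactin (product_topology (\<lambda>_. euclidean) UNIV) K"
    unfolding K_def compactin_PiE by simp
  then have "compact K" by (simp add: euclidean_product_topology)
  moreover have "filtermap ev F \<noteq> bot" using F by (simp add: filtermap_bot_iff)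
  moreover have "\<forall>\<^sub>F f in filtermap ev F. f \<in> K"
    unfolding eventually_filtermap
  proof (rule eventually_mono[OF bdd])
    fix t assume t: "norm (x t) \<le> M"
    have "\<bar>inner (x t) z\<bar> \<le> M * norm z" for z
      using Cauchy_Schwarz_ineq2[of "x t" z] mult_right_mono[OF t norm_ge_zero[of z]] by linarith
    then show "ev t \<in> K" by (auto simp: ev_def K_def abs_le_iff minus_le_iff)
  qed
  ultimately obtain \<phi> where \<phi>: "\<phi> \<in> K" "inf (nhds \<phi>) (filtermap ev F) \<noteq> bot"
    unfolding compact_filter by meson
  \<comment> \<open>The refinement of \<open>F\<close> on which \<open>ev\<close> is forced close to
    \<phi>: along it the cluster point becomes a limit.\<close>
  define G where "G = inf F (filtercomap ev (nhds \<phi>))"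
  have "G \<noteq> bot"
  proof
    assume "G = bot"
    then have "eventually (\<lambda>_. False) G" by simp
    then obtain Q P where QP: "eventually Q F" "eventually P (nhds \<phi>)" "\<And>t. Q t \<Longrightarrow> P (ev t) \<Longrightarrow> False"
      unfolding G_def eventually_inf eventually_filtercomap by metis
    have "\<forall>\<^sub>F f in filtermap ev F. \<not> P f"
      unfolding eventually_filtermap using QP(1) by (rule eventually_mono) (use QP(3) in blast)
    with QP(2) have "eventually (\<lambda>_. False) (inf (nhds \<phi>) (filtermap ev F))"
      unfolding eventually_inf by blast
    with \<phi>(2) show False by (simp add: trivial_limit_def)
  qed
  have "filterlim ev (nhds \<phi>) G"
    unfolding G_def by (rule filterlim_mono[OF filterlim_filtercomap order_refl]) simp
  then have lim: "((\<lambda>t. inner (x t) z) \<longlongrightarrow> \<phi> z) G" for z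
    using continuous_on_tendsto_compose[OF continuous_on_product_coordinates[of z], of ev \<phi> G]
    by (simp add: ev_def)
  \<comment> \<open>Convergence in the product topology is pointwise, so linearity passes to the
    limit; membership in \<open>K\<close> supplies the bound \<open>M\<close>.\<close>
  have "bounded_linear \<phi>"
  proof
    fix y z and c :: real
    have "((\<lambda>t. inner (x t) (y + z)) \<longlongrightarrow> \<phi> y + \<phi> z) G"
      using tendsto_add[OF lim[of y] lim[of z]] by (simp add: inner_add_right)
    then show "\<phi> (y + z) = \<phi> y + \<phi> z" by (rule tendsto_unique[OF \<open>G \<noteq> bot\<close> lim])
    have "((\<lambda>t. inner (x t) (c *\<^sub>R z)) \<longlongrightarrow> c * \<phi> z) G"
      using tendsto_mult[OF tendsto_const lim[of z]] by simp
    then show "\<phi> (c *\<^sub>R z) = c *\<^sub>R \<phi> z" using tendsto_unique[OF \<open>G \<noteq> bot\<close> lim] by simp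
    show "\<exists>K. \<forall>z. norm (\<phi> z) \<le> norm z * K"
    proof (intro exI allI)
      fix z
      have "\<phi> z \<in> {- (M * norm z)..M * norm z}" using \<phi>(1) unfolding K_def by blast
      then show "norm (\<phi> z) \<le> norm z * M" by (auto simp: mult.commute)
    qed
  qed
  then obtain p where "\<And>z. \<phi> z = inner p z" using Riesz_representation by blast
  with lim have "weakly_tendsto x p G" by (simp add: weakly_tendsto_def)
  moreover have "G \<le> F" by (simp add: G_def)
  ultimately show thesis using \<open>G \<noteq> bot\<close> that by blast
qed

lemma weakly_tendstoD: "weakly_tendsto x p F \<Longrightarrow> ((\<lambda>t. inner (x t) z) \<longlongrightarrow> inner p z) F"
  unfolding weakly_tendsto_def by blast

text \<open>Expand |x t - T p|^2 around \<open>p\<close> and bound it by (h t + |x t - p|)^2. The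
  terms |x t - p|^2 cancel, so |p - T p|^2 is dominated by terms with the factor \<open>h t\<close>
  and by a scalar product that vanishes in the weak limit.\<close>

lemma demiclosed_nonexpansive:
  fixes T :: "'a::real_inner \<Rightarrow> 'a"
  assumes T: "\<And>u v. norm (T u - T v) \<le> norm (u - v)"
    and w: "weakly_tendsto x p G" and G: "G \<noteq> bot" and bdd: "\<forall>\<^sub>F t in G. norm (x t) \<le> M"
    and lim: "((\<lambda>t. T (x t) - x t) \<longlongrightarrow> 0) G"
  shows "T p = p"
proof -
  define h where "h = (\<lambda>t. norm (T (x t) - x t))"
  have h: "(h \<longlongrightarrow> 0) G" unfolding h_def using tendsto_norm[OF lim] by simp
  define e where "e = (\<lambda>t. (h t)\<^sup>2 + 2 * h t * (M + norm p) - 2 * (inner (x t) (p - T p) - inner p (p - T p)))"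
  have "(e \<longlongrightarrow> 0\<^sup>2 + 2 * 0 * (M + norm p) - 2 * (inner p (p - T p) - inner p (p - T p))) G"
    unfolding e_def by (intro tendsto_intros h weakly_tendstoD[OF w])
  moreover have "\<forall>\<^sub>F t in G. (norm (p - T p))\<^sup>2 \<le> e t"
  proof (rule eventually_mono[OF bdd])
    fix t assume t: "norm (x t) \<le> M"
    have b: "norm (x t - p) \<le> M + norm p" using norm_triangle_ineq4[of "x t" p] t by linarith
    have "norm (x t - T p) \<le> h t + norm (x t - p)"
      using T[of "x t" p] norm_triangle_ineq[of "x t - T (x t)" "T (x t) - T p"]
      by (simp add: h_def norm_minus_commute)
    then have "(norm (x t - T p))\<^sup>2 \<le> (h t + norm (x t - p))\<^sup>2" by (rule power_mono) simp
    moreover have "(norm (x t - T p))\<^sup>2 = (norm (x t - p))\<^sup>2 + 2 * inner (x t - p) (p - T p) + (norm (p - T p))\<^sup>2"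
      by (simp add: power2_norm_eq_inner inner_diff_left inner_diff_right inner_commute algebra_simps)
    moreover have "2 * h t * norm (x t - p) \<le> 2 * h t * (M + norm p)"
      using b by (intro mult_left_mono) (auto simp: h_def)
    ultimately show "(norm (p - T p))\<^sup>2 \<le> e t"
      by (simp add: e_def power2_sum inner_diff_left)
  qed
  ultimately have "(norm (p - T p))\<^sup>2 \<le> 0\<^sup>2 + 2 * 0 * (M + norm p) - 2 * (inner p (p - T p) - inner p (p - T p))"
    using G by (rule tendsto_lowerbound)
  then show ?thesis by simp
qed

text \<open>The difference of the squared distances to \<open>p\<close> and \<open>q\<close> is
  affine in \<open>x t\<close>. If both distances converge, so does the scalar product of
  \<open>x t\<close> with \<open>p - q\<close> along all of \<open>F\<close>, and comparing its
  limits at two weak cluster points gives |p - q|^2 = 0.\<close>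

lemma Opial:
  fixes x :: "'b \<Rightarrow> 'a::{real_inner, complete_space}"
  assumes F: "F \<noteq> bot" and bdd: "\<forall>\<^sub>F t in F. norm (x t) \<le> M"
    and dist: "\<And>y. y \<in> Z \<Longrightarrow> \<exists>l. ((\<lambda>t. norm (x t - y)) \<longlongrightarrow> l) F"
    and cluster: "\<And>G p. G \<le> F \<Longrightarrow> G \<noteq> bot \<Longrightarrow> weakly_tendsto x p G \<Longrightarrow> p \<in> Z"
  shows "\<exists>p\<in>Z. weakly_tendsto x p F"
proof -
  have unique: "p = q" if p: "G \<le> F" "G \<noteq> bot" "weakly_tendsto x p G"
    and q: "H \<le> F" "H \<noteq> bot" "weakly_tendsto x q H" for G H p q
  proof -
    obtain l m where l: "((\<lambda>t. norm (x t - p)) \<longlongrightarrow> l) F" and m: "((\<lambda>t. norm (x t - q)) \<longlongrightarrow> m) F"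
      using dist cluster p q by metis
    define c where "c = m\<^sup>2 - l\<^sup>2 + (norm p)\<^sup>2 - (norm q)\<^sup>2"
    have "((\<lambda>t. (norm (x t - q))\<^sup>2 - (norm (x t - p))\<^sup>2 + (norm p)\<^sup>2 - (norm q)\<^sup>2) \<longlongrightarrow> c) F"
      unfolding c_def by (intro tendsto_intros l m)
    moreover have "(norm (x t - q))\<^sup>2 - (norm (x t - p))\<^sup>2 + (norm p)\<^sup>2 - (norm q)\<^sup>2 = 2 * inner (x t) (p - q)" for t
      by (simp add: power2_norm_eq_inner inner_diff_left inner_diff_right inner_commute algebra_simps)
    ultimately have c: "((\<lambda>t. 2 * inner (x t) (p - q)) \<longlongrightarrow> c) F" by simp
    have "((\<lambda>t. 2 * inner (x t) (p - q)) \<longlongrightarrow> 2 * inner r (p - q)) K" if "weakly_tendsto x r K" for r K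
      using that unfolding weakly_tendsto_def by (intro tendsto_mult tendsto_const) blast
    then have "2 * inner p (p - q) = c" "2 * inner q (p - q) = c"
      using p q c by (meson tendsto_mono tendsto_unique)+
    then have "inner (p - q) (p - q) = 0" by (simp add: inner_diff_left)
    then show "p = q" by simp
  qed
  obtain G p where G: "G \<le> F" "G \<noteq> bot" "weakly_tendsto x p G"
    by (rule weakly_convergent_subfilter[OF F bdd])
  have "weakly_tendsto x p F"
    unfolding weakly_tendsto_def tendsto_iff
  proof (intro allI impI, rule ccontr)
    fix z and e :: real assume e: "e > 0" "\<not> (\<forall>\<^sub>F t in F. dist (inner (x t) z) (inner p z) < e)"
    \<comment> \<open>Along the times that violate the bound \<open>e\<close> there is again a weak
      cluster point. It must equal \<open>p\<close>, contrary to the choice of these times.\<close>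
    define F' where "F' = inf F (principal {t. e \<le> dist (inner (x t) z) (inner p z)})"
    have "F' \<noteq> bot"
    proof
      assume "F' = bot"
      then have "eventually (\<lambda>_. False) F'" by simp
      with e(2) show False unfolding F'_def eventually_inf_principal by (simp add: not_le)
    qed
    moreover have "\<forall>\<^sub>F t in F'. norm (x t) \<le> M"
      using bdd unfolding F'_def by (auto simp: eventually_inf_principal elim: eventually_mono)
    ultimately obtain H q where H: "H \<le> F'" "H \<noteq> bot" "weakly_tendsto x q H"
      by (rule weakly_convergent_subfilter)
    have "H \<le> F" using H(1) by (simp add: F'_def)
    then have "q = p" using unique G H by blast
    then have "\<forall>\<^sub>F t in H. dist (inner (x t) z) (inner p z) < e"
      using H(3) e(1) unfolding weakly_tendsto_def tendsto_iff by blast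
    moreover have "\<forall>\<^sub>F t in H. e \<le> dist (inner (x t) z) (inner p z)"
    proof (rule filter_leD[OF H(1)])
      show "\<forall>\<^sub>F t in F'. e \<le> dist (inner (x t) z) (inner p z)"
        unfolding F'_def by (simp add: eventually_inf_principal)
    qed
    ultimately have "eventually (\<lambda>_. False) H" by eventually_elim simp
    with H(2) show False by (simp add: trivial_limit_def)
  qed
  with cluster[OF G] show ?thesis by blast
qed

section \<open>A comparison principle for Dini derivatives\<close>

text \<open>A continuation argument: continuity puts the supremum \<open>c\<close> of the good times
  into \<open>S\<close>, and the local condition at \<open>c\<close> pushes past it unless
  \<open>c = b\<close>.\<close>

lemma continuous_locally_right_le_imp_le:
  fixes G :: "real \<Rightarrow> real"
  assumes "a \<le> b" and cont: "continuous_on {a..b} G"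
    and loc: "\<And>t. a \<le> t \<Longrightarrow> t < b \<Longrightarrow> \<forall>\<^sub>F s in at_right t. G s \<le> G t"
  shows "G b \<le> G a"
proof -
  define S where "S = {t \<in> {a..b}. \<forall>r\<in>{a..t}. G r \<le> G a}"
  define c where "c = Sup S"
  have aS: "a \<in> S" using \<open>a \<le> b\<close> by (auto simp: S_def)
  have bdd: "bdd_above S" by (rule bdd_aboveI[of _ b]) (auto simp: S_def)
  have "S \<noteq> {}" "\<And>t. t \<in> S \<Longrightarrow> t \<le> b" using aS by (auto simp: S_def)
  then have c: "a \<le> c" "c \<le> b"
    unfolding c_def by (simp_all add: cSup_upper[OF aS bdd] cSup_least)
  have below: "G r \<le> G a" if r: "a \<le> r" "r < c" for r
  proof -
    obtain t where "t \<in> S" "r < t" using r(2) less_cSup_iff[OF _ bdd, of r] aS unfolding c_def by auto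
    then show ?thesis using r by (auto simp: S_def)
  qed
  have "G c \<le> G a"
  proof (cases "a = c")
    case False
    then have ac: "a < c" using c by simp
    have "(G \<longlongrightarrow> G c) (at c within {a..c})"
      using cont c continuous_on_subset[OF cont, of "{a..c}"] by (auto simp: continuous_on_def)
    then have "(G \<longlongrightarrow> G c) (at_left c)"
      using ac by (simp add: at_within_Icc_at_left)
    moreover have "\<forall>\<^sub>F r in at_left c. G r \<le> G a"
      using eventually_at_left_real[OF ac] by eventually_elim (auto intro: below)
    ultimately show ?thesis by (rule tendsto_upperbound) simp
  qed simp
  then have cS: "c \<in> S"
  proof -
    have "G r \<le> G a" if "r \<in> {a..c}" for r
      using that below[of r] \<open>G c \<le> G a\<close> by (cases "r = c") auto
    then show ?thesis using c by (simp add: S_def)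
  qed
  have "c = b"
  proof (rule ccontr)
    assume "c \<noteq> b"
    then have cb: "c < b" using c by simp
    obtain d where d: "d > c" "\<And>s. c < s \<Longrightarrow> s < d \<Longrightarrow> G s \<le> G c"
      using loc[OF c(1) cb] unfolding eventually_at_right_field by blast
    define s where "s = min b ((c + d) / 2)"
    have s: "c < s" "s \<le> b" "s < d" using d(1) cb by (auto simp: s_def min_def field_simps)
    have "s \<in> S"
      unfolding S_def
    proof (clarsimp simp: s(2) c(1) order.trans[OF c(1) less_imp_le[OF s(1)]])
      fix r assume "a \<le> r" "r \<le> s"
      then show "G r \<le> G a"
        using cS s d(2)[of r] \<open>G c \<le> G a\<close> below[of r] by (cases r c rule: linorder_cases) auto
    qed
    then have "s \<le> c" unfolding c_def using bdd by (rule cSup_upper)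
    with s show False by simp
  qed
  with \<open>G c \<le> G a\<close> show ?thesis by simp
qed

lemma negligible_open_cover_small_integral:
  fixes k :: "real \<Rightarrow> real"
  assumes N: "negligible N" and k: "k absolutely_integrable_on {a..b}" "\<And>t. 0 \<le> k t" and e: "0 < e"
  obtains U where "open U" "N \<subseteq> U" "integral {a..b} (\<lambda>t. indicator U t * k t) < e"
proof -
  have Ns: "N \<in> lmeasurable" "measure lebesgue N = 0"
    using N by (auto simp: negligible_iff_measure)
  have "\<exists>U. open U \<and> N \<subseteq> U \<and> emeasure lebesgue (U - N) < ennreal (1 / Suc n)" for n
  proof -
    have "0 < 1 / real (Suc n)" by simp
    then obtain U where "open U" "N \<subseteq> U" "U - N \<in> lmeasurable" "emeasure lebesgue (U - N) < ennreal (1 / Suc n)"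
      by (rule sets_lebesgue_outer_open[OF fmeasurableD[OF Ns(1)]])
    then show ?thesis by blast
  qed
  then obtain V where V: "\<And>n. open (V n)" "\<And>n. N \<subseteq> V n" "\<And>n. emeasure lebesgue (V n - N) < ennreal (1 / Suc n)"
    by metis
  \<comment> \<open>Finite intersections make the open sets decrease, so a point outside some
    \<open>U m\<close> stays outside all later ones. This gives the pointwise convergence needed for
    dominated convergence.\<close>
  define U where "U = (\<lambda>n::nat. \<Inter>i\<in>{..n}. V i)"
  have U: "open (U n)" "N \<subseteq> U n" for n unfolding U_def using V by auto
  have [measurable]: "V n \<in> sets lebesgue" "U n \<in> sets lebesgue" for n using V(1) U(1) by auto
  have neg: "negligible (\<Inter>n. U n)"
  proof -
    have "emeasure lebesgue ((\<Inter>n. V n) - N) \<le> ennreal (1 / Suc n)" for n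
    proof -
      have "emeasure lebesgue ((\<Inter>n. V n) - N) \<le> emeasure lebesgue (V n - N)"
        using Ns by (intro emeasure_mono) (auto simp: fmeasurableD)
      with V(3)[of n] show ?thesis by simp
    qed
    then have "emeasure lebesgue ((\<Inter>n. V n) - N) \<le> ennreal 0"
    proof (intro LIMSEQ_le_const[of "\<lambda>n. ennreal (1 / Suc n)"])
      have "(\<lambda>n. 1 / real (Suc n)) \<longlonglongrightarrow> 0"
        using LIMSEQ_inverse_real_of_nat by (simp add: inverse_eq_divide)
      then show "(\<lambda>n. ennreal (1 / Suc n)) \<longlonglongrightarrow> ennreal 0" by (rule tendsto_ennrealI)
    qed blast
    then have "(\<Inter>n. V n) - N \<in> null_sets lebesgue"
      using Ns by (auto simp: null_sets_def fmeasurableD)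
    then have "negligible ((\<Inter>n. V n) - N)" by (simp add: negligible_iff_null_sets)
    then have "negligible (((\<Inter>n. V n) - N) \<union> N)" using N by (rule negligible_Un)
    then show ?thesis by (rule negligible_subset) (auto simp: U_def)
  qed
  have int: "(\<lambda>t. indicator (U n) t * k t) absolutely_integrable_on {a..b}" for n
  proof -
    have "k absolutely_integrable_on {a..b} \<inter> U n"
      using k(1) by (rule set_integrable_subset) auto
    then show ?thesis
      by (simp add: set_integrable_def indicator_inter_arith mult.assoc mult.commute mult.left_commute)
  qed
  define f0 where "f0 = (\<lambda>t. indicator (\<Inter>n. U n) t * k t)"
  have "(\<lambda>n. integral {a..b} (\<lambda>t. indicator (U n) t * k t)) \<longlonglongrightarrow> integral {a..b} f0"
  proof (rule dominated_convergence(2))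
    show "(\<lambda>t. indicator (U n) t * k t) integrable_on {a..b}" for n
      using int by (rule set_lebesgue_integral_eq_integral(1))
    show "k integrable_on {a..b}" using k(1) by (rule set_lebesgue_integral_eq_integral(1))
    show "norm (indicator (U n) t * k t) \<le> k t" for n t using k(2)[of t] by (simp add: indicator_def)
    fix t assume "t \<in> {a..b}"
    show "(\<lambda>n. indicator (U n) t * k t) \<longlonglongrightarrow> f0 t"
    proof (cases "t \<in> (\<Inter>n. U n)")
      case True
      then show ?thesis by (auto simp: f0_def indicator_def)
    next
      case False
      then obtain m where "t \<notin> U m" by blast
      then have "t \<notin> U n" if "n \<ge> m" for n using that by (auto simp: U_def)
      then have "\<forall>\<^sub>F n in sequentially. indicator (U n) t * k t = f0 t"
        using False by (auto simp: f0_def indicator_def eventually_sequentially intro!: exI[of _ m])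
      then show ?thesis by (rule tendsto_eventually)
    qed
  qed
  moreover have "integral {a..b} f0 = 0"
  proof -
    have "(f0 has_integral 0) {a..b}"
      by (rule has_integral_negligible[OF neg]) (auto simp: f0_def)
    then show ?thesis by (rule integral_unique)
  qed
  ultimately have "\<forall>\<^sub>F n in sequentially. integral {a..b} (\<lambda>t. indicator (U n) t * k t) < e"
    using e by (auto dest: order_tendstoD)
  then obtain n where "integral {a..b} (\<lambda>t. indicator (U n) t * k t) < e"
    by (auto simp: eventually_sequentially)
  with U that show thesis by blast
qed

text \<open>
  The exceptional null set is covered by an open set \<open>U\<close> over which \<open>k\<close> has small integral; the primitive of
  \<open>k\<close> restricted to \<open>U\<close> compensates the uncontrolled growth of \<open>f\<close> on that set.
\<close>

theorem AE_Dini_bound: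
  fixes f k :: "real \<Rightarrow> real"
  assumes ab: "a \<le> b"
    and k: "k absolutely_integrable_on {a..b}" "\<And>t. 0 \<le> k t"
    and fk: "\<And>s t. a \<le> s \<Longrightarrow> s \<le> t \<Longrightarrow> t \<le> b \<Longrightarrow> \<bar>f t - f s\<bar> \<le> integral {s..t} k"
    and N: "negligible N" and C: "0 \<le> C"
    and Dini: "\<And>t e. a \<le> t \<Longrightarrow> t < b \<Longrightarrow> t \<notin> N \<Longrightarrow> 0 < e \<Longrightarrow>
      \<forall>\<^sub>F s in at_right t. f s - f t \<le> (C + e) * (s - t)"
  shows "f b \<le> f a + C * (b - a)"
proof (rule field_le_epsilon)
  fix e0 :: real assume e0: "0 < e0"
  \<comment> \<open>The excess slope \<open>e\<close> over the length \<open>b - a\<close> and one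
    more \<open>e\<close> from the integral over \<open>U\<close> add up to
    \<open>e0\<close>.\<close>
  define e where "e = e0 / (b - a + 1)"
  have e: "0 < e" using e0 ab by (simp add: e_def)
  obtain U where U: "open U" "N \<subseteq> U" "integral {a..b} (\<lambda>t. indicator U t * k t) < e"
    by (rule negligible_open_cover_small_integral[OF N k e])
  define u where "u = (\<lambda>t. indicator U t * k t)"
  have u_nonneg: "0 \<le> u t" for t using k(2) by (simp add: u_def)
  have kint: "k integrable_on {a..b}" using k(1) by (rule set_lebesgue_integral_eq_integral(1))
  have uint: "u integrable_on {a..b}"
  proof -
    have "k absolutely_integrable_on {a..b} \<inter> U"
      using k(1) by (rule set_integrable_subset) (use U(1) in auto)
    then have "u absolutely_integrable_on {a..b}"
      by (simp add: u_def set_integrable_def indicator_inter_arith mult.assoc mult.commute mult.left_commute)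
    then show ?thesis by (rule set_lebesgue_integral_eq_integral(1))
  qed
  define V where "V = (\<lambda>t. integral {a..t} u)"
  have V_diff: "V t - V s = integral {s..t} u" if "a \<le> s" "s \<le> t" "t \<le> b" for s t
  proof -
    have "u integrable_on {a..t}" using uint by (rule integrable_on_subinterval) (use that in auto)
    then show ?thesis using Henstock_Kurzweil_Integration.integral_combine[where a=a and c=s and b=t and f=u] that by (simp add: V_def)
  qed
  have V_mono: "V s \<le> V t" if "a \<le> s" "s \<le> t" "t \<le> b" for s t
  proof -
    have "u integrable_on {s..t}" using uint by (rule integrable_on_subinterval) (use that in auto)
    then have "0 \<le> integral {s..t} u" by (rule integral_nonneg) (rule u_nonneg)
    then show ?thesis using V_diff[OF that] by simp
  qed
  have V_cont: "continuous_on {a..b} V"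
    unfolding V_def using uint by (rule indefinite_integral_continuous_1)
  have f_cont: "continuous_on {a..b} f"
  proof -
    define W where "W = (\<lambda>t. integral {a..t} k)"
    have W_cont: "continuous_on {a..b} W"
      unfolding W_def using kint by (rule indefinite_integral_continuous_1)
    have "\<bar>f t - f s\<bar> \<le> \<bar>W t - W s\<bar>" if "a \<le> s" "s \<le> t" "t \<le> b" for s t
    proof -
      have "k integrable_on {a..t}" using kint by (rule integrable_on_subinterval) (use that in auto)
      then have "W t - W s = integral {s..t} k"
        using Henstock_Kurzweil_Integration.integral_combine[where a=a and c=s and b=t and f=k] that by (simp add: W_def)
      then show ?thesis using fk[OF that] by simp
    qed
    note * = this
    have "\<bar>f t - f s\<bar> \<le> \<bar>W t - W s\<bar>" if "s \<in> {a..b}" "t \<in> {a..b}" for s t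
      using that *[of s t] *[of t s] by (cases "s \<le> t") (auto simp: abs_minus_commute)
    then have le: "dist (f t) (f s) \<le> dist (W t) (W s)" if "s \<in> {a..b}" "t \<in> {a..b}" for s t
      using that by (simp add: dist_real_def)
    show ?thesis
      unfolding continuous_on_iff
    proof (intro ballI allI impI)
      fix s and e :: real assume s: "s \<in> {a..b}" and "0 < e"
      then obtain d where d: "0 < d" "\<And>t. t \<in> {a..b} \<Longrightarrow> dist t s < d \<Longrightarrow> dist (W t) (W s) < e"
        using W_cont unfolding continuous_on_iff by blast
      have "dist (f t) (f s) < e" if "t \<in> {a..b}" "dist t s < d" for t
        using le[OF s that(1)] d(2)[OF that] by linarith
      with d(1) show "\<exists>d>0. \<forall>t\<in>{a..b}. dist t s < d \<longrightarrow> dist (f t) (f s) < e" by blast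
    qed
  qed
  \<comment> \<open>Off \<open>N\<close> the Dini hypothesis makes \<open>G\<close> decrease locally
    to the right. At a point of \<open>N\<close> a right neighbourhood lies in \<open>U\<close>,
    where \<open>V\<close> grows at least as fast as \<open>f\<close>.\<close>
  define G where "G = (\<lambda>t. f t - V t - (C + e) * (t - a))"
  have "G b \<le> G a"
  proof (rule continuous_locally_right_le_imp_le[OF ab])
    show "continuous_on {a..b} G" unfolding G_def by (intro continuous_intros f_cont V_cont)
    fix t assume t: "a \<le> t" "t < b"
    show "\<forall>\<^sub>F s in at_right t. G s \<le> G t"
    proof (cases "t \<in> N")
      case False
      from Dini[OF t False e] eventually_at_right_real[OF t(2)] show ?thesis
      proof eventually_elim
        case (elim s)
        then show ?case using V_mono[of t s] t by (auto simp: G_def algebra_simps)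
      qed
    next
      case True
      then obtain d where d: "d > 0" "ball t d \<subseteq> U" using U by (meson openE subsetD)
      have "t < min (t + d) b" using d(1) t by simp
      from eventually_at_right_real[OF this] show ?thesis
      proof eventually_elim
        case (elim s)
        then have s: "t < s" "s < t + d" "s < b" by auto
        have "integral {t..s} u = integral {t..s} k"
        proof (rule integral_cong)
          fix r assume "r \<in> {t..s}"
          then have "r \<in> U" using d(2) s by (auto simp: dist_real_def)
          then show "u r = k r" by (simp add: u_def)
        qed
        then have "f s - f t \<le> V s - V t"
          using fk[of t s] V_diff[of t s] s t by auto
        moreover have "0 \<le> (C + e) * (s - t)" using C e s by simp
        ultimately show ?case by (simp add: G_def algebra_simps)
      qed
    qed
  qed
  then have "f b \<le> f a + V b + (C + e) * (b - a)"
    by (simp add: G_def V_def)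
  also have "\<dots> \<le> f a + e + (C + e) * (b - a)"
    using U(3) by (simp add: V_def u_def)
  also have "\<dots> = f a + C * (b - a) + e * (b - a + 1)" by (simp add: algebra_simps)
  also have "e * (b - a + 1) = e0" using ab by (simp add: e_def)
  finally show "f b \<le> f a + C * (b - a) + e0" by simp
qed

section \<open>Absolutely continuous curves\<close>

text \<open>In a non-separable space the difference of two Borel functions may fail to be Borel.
  Since \<open>s\<close> takes finitely many values, each piece subtracts only a constant.\<close>

lemma measurable_norm_diff_simple:
  fixes f s :: "'b \<Rightarrow> 'a::real_normed_vector"
  assumes f: "f \<in> borel_measurable M" and s: "simple_function M s"
  shows "(\<lambda>t. norm (f t - s t)) \<in> borel_measurable M"
proof (rule measurable_compose_countable'[where f = "\<lambda>c t. norm (f t - c)" and g = s and I = "s ` space M"])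
  fix c :: 'a
  have "(\<lambda>v. norm (v - c)) \<in> borel_measurable borel"
    by (intro borel_measurable_continuous_onI continuous_intros)
  with f show "(\<lambda>t. norm (f t - c)) \<in> borel_measurable M" by (rule measurable_compose)
next
  show "s \<in> measurable M (count_space (s ` space M))" "countable (s ` space M)"
    using s unfolding simple_function_def by (auto simp: measurable_count_space_eq2 countable_finite)
qed

text \<open>The approximating simple functions, paired with \<open>z\<close>, approximate the paired
  integrand by Cauchy-Schwarz. This is the passage from vector-valued to real integrals.\<close>

lemma has_bochner_integral_nonsep_inner:
  assumes "has_bochner_integral_nonsep M f I"
  shows "has_bochner_integral M (\<lambda>t. inner (f t) z) (inner I z)"
proof -
  obtain s where f: "f \<in> borel_measurable M"
    and s: "\<And>i. Bochner_Integration.simple_bochner_integrable M (s i)"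
    and lim: "(\<lambda>i. \<integral>\<^sup>+t. norm (f t - s i t) \<partial>M) \<longlonglongrightarrow> 0"
    and I: "(\<lambda>i. Bochner_Integration.simple_bochner_integral M (s i)) \<longlonglongrightarrow> I"
    using assms unfolding has_bochner_integral_nonsep_def by blast
  interpret T: bounded_linear "\<lambda>v. inner v z" by (rule bounded_linear_inner_left)
  show ?thesis
  proof (rule has_bochner_integral.intros)
    have "(\<lambda>v. inner v z) \<in> borel_measurable borel"
      by (intro borel_measurable_continuous_onI continuous_intros)
    with f show "(\<lambda>t. inner (f t) z) \<in> borel_measurable M" by (rule measurable_compose)
    show "\<And>i. Bochner_Integration.simple_bochner_integrable M (\<lambda>t. inner (s i t) z)"
      by (rule simple_bochner_integrable_compose2[where p = "\<lambda>u v. inner u z", OF _ s s]) simp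
    show "(\<lambda>i. \<integral>\<^sup>+t. norm (inner (f t) z - inner (s i t) z) \<partial>M) \<longlonglongrightarrow> 0"
      (is "?f \<longlonglongrightarrow> 0")
    proof (rule tendsto_sandwich[where f = "\<lambda>_. 0"])
      show "eventually (\<lambda>i. ?f i \<le> norm z * (\<integral>\<^sup>+t. norm (f t - s i t) \<partial>M)) sequentially"
      proof (intro always_eventually allI)
        fix i
        have "?f i \<le> (\<integral>\<^sup>+t. ennreal (norm z) * norm (f t - s i t) \<partial>M)"
          by (intro nn_integral_mono)
            (simp add: inner_diff_left[symmetric] ennreal_mult[symmetric], metis Cauchy_Schwarz_ineq2 mult.commute)
        also have "\<dots> = norm z * (\<integral>\<^sup>+t. norm (f t - s i t) \<partial>M)"
          using measurable_norm_diff_simple[OF f] s[of i]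
          by (intro nn_integral_cmult) (auto elim: simple_bochner_integrable.cases)
        finally show "?f i \<le> norm z * (\<integral>\<^sup>+t. norm (f t - s i t) \<partial>M)" .
      qed
      show "(\<lambda>i. norm z * (\<integral>\<^sup>+t. norm (f t - s i t) \<partial>M)) \<longlonglongrightarrow> 0"
        using ennreal_tendsto_cmult[OF _ lim, of "ennreal (norm z)"] by simp
    qed auto
    have "Bochner_Integration.simple_bochner_integral M (\<lambda>t. inner (s i t) z) = inner (Bochner_Integration.simple_bochner_integral M (s i)) z" for i
      by (rule simple_bochner_integral_linear[OF T.linear_axioms s])
    then show "(\<lambda>i. Bochner_Integration.simple_bochner_integral M (\<lambda>t. inner (s i t) z)) \<longlonglongrightarrow> inner I z"
      using T.tendsto[OF I] by simp
  qed
qed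

text \<open>One simple function at L1-distance less than 1 from \<open>f\<close> suffices, by the
  triangle inequality.\<close>

lemma has_bochner_integral_nonsep_integrable_norm:
  fixes f :: "'b \<Rightarrow> 'a::real_normed_vector"
  assumes "has_bochner_integral_nonsep M f I"
  shows "integrable M (\<lambda>t. norm (f t))"
proof -
  obtain s where f: "f \<in> borel_measurable M"
    and s: "\<And>i::nat. Bochner_Integration.simple_bochner_integrable M (s i)"
    and lim: "(\<lambda>i. \<integral>\<^sup>+t. norm (f t - s i t) \<partial>M) \<longlonglongrightarrow> 0"
    using assms unfolding has_bochner_integral_nonsep_def by blast
  have "\<forall>\<^sub>F i in sequentially. (\<integral>\<^sup>+t. norm (f t - s i t) \<partial>M) < 1"
    using lim by (rule order_tendstoD) simp
  then obtain i where i: "(\<integral>\<^sup>+t. norm (f t - s i t) \<partial>M) < 1"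
    by (auto simp: eventually_sequentially)
  have "Bochner_Integration.simple_bochner_integrable M (\<lambda>t. norm (s i t))"
    by (rule simple_bochner_integrable_compose2[where p = "\<lambda>u v. norm u", OF _ s s]) simp
  then have "integrable M (\<lambda>t. norm (s i t))" by (rule integrableI_simple_bochner_integrable)
  then have si: "(\<integral>\<^sup>+t. norm (s i t) \<partial>M) < \<infinity>" "(\<lambda>t. norm (s i t)) \<in> borel_measurable M"
    by (auto simp: integrable_iff_bounded)
  have nf: "(\<lambda>t. norm (f t)) \<in> borel_measurable M"
    using f by (rule measurable_compose) (intro borel_measurable_continuous_onI continuous_intros)
  have md: "(\<lambda>t. norm (f t - s i t)) \<in> borel_measurable M"
    using f s[of i] by (auto intro: measurable_norm_diff_simple elim: simple_bochner_integrable.cases)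
  have "(\<integral>\<^sup>+t. norm (f t) \<partial>M) \<le> (\<integral>\<^sup>+t. ennreal (norm (f t - s i t)) + ennreal (norm (s i t)) \<partial>M)"
    using norm_triangle_sub by (intro nn_integral_mono) (auto simp: ennreal_plus[symmetric] add.commute simp del: ennreal_plus)
  also have "\<dots> = (\<integral>\<^sup>+t. norm (f t - s i t) \<partial>M) + (\<integral>\<^sup>+t. norm (s i t) \<partial>M)"
    using md si(2) by (intro nn_integral_add) auto
  also have "\<dots> < \<infinity>" using i si(1) by (auto simp: less_top[symmetric])
  finally show ?thesis using nf by (simp add: integrable_iff_bounded)
qed

text \<open>The increment is tested against itself: with \<open>z = x t - x s\<close>, |z|^2 is a
  real integral, at most |z| times the integral of \<open>k\<close>, and one factor |z|
  cancels.\<close>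

lemma locally_absolutely_continuous_bound:
  fixes x :: "real \<Rightarrow> 'a::real_inner"
  assumes "locally_absolutely_continuous x" and b: "0 < b"
  obtains k where "k absolutely_integrable_on {0..b}" "\<And>t. 0 \<le> k t"
    "\<And>s t. 0 \<le> s \<Longrightarrow> s \<le> t \<Longrightarrow> t \<le> b \<Longrightarrow> norm (x t - x s) \<le> integral {s..t} k"
proof -
  obtain c g where g: "\<And>t. t \<in> {0..b} \<Longrightarrow> has_bochner_integral_nonsep (lebesgue_on {0..t}) g (x t - c)"
    using assms unfolding locally_absolutely_continuous_def by blast
  define k where "k = (\<lambda>t. norm (g t))"
  have "integrable (lebesgue_on {0..b}) k"
    unfolding k_def using b by (intro has_bochner_integral_nonsep_integrable_norm[OF g]) auto
  then have k: "k absolutely_integrable_on {0..b}"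
    using integrable_on_lebesgue_on[of "{0..b}" k]
    by (subst absolutely_integrable_on_iff_nonneg) (auto simp: k_def)
  then have kint: "k integrable_on {0..b}" by (rule set_lebesgue_integral_eq_integral(1))
  have "norm (x t - x s) \<le> integral {s..t} k" if st: "0 \<le> s" "s \<le> t" "t \<le> b" for s t
  proof -
    define z where "z = x t - x s"
    define f where "f = (\<lambda>r. inner (g r) z)"
    have f: "f integrable_on {0..r}" "integral {0..r} f = inner (x r - c) z" if "r \<in> {0..b}" for r
      using has_bochner_integral_nonsep_inner[OF g[OF that], of z]
        integrable_on_lebesgue_on[of "{0..r}" f] lebesgue_integral_eq_integral[of "{0..r}" f]
      by (auto simp: has_bochner_integral_iff f_def)
    have ft: "f integrable_on {s..t}"
      using f(1)[of t] st by (auto intro: integrable_on_subinterval)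
    have kt: "k integrable_on {s..t}"
      using kint st by (auto intro: integrable_on_subinterval)
    have "(norm z)\<^sup>2 = inner (x t - c) z - inner (x s - c) z"
      by (simp add: z_def power2_norm_eq_inner inner_diff_left)
    also have "\<dots> = integral {s..t} f"
      using Henstock_Kurzweil_Integration.integral_combine[where a=0 and c=s and b=t and f=f] f[of s] f[of t] st by auto
    also have "\<dots> \<le> integral {s..t} (\<lambda>r. k r * norm z)"
    proof (rule integral_le[OF ft])
      show "(\<lambda>r. k r * norm z) integrable_on {s..t}"
        using kt by (rule integrable_on_mult_left)
      show "f r \<le> k r * norm z" for r
        unfolding f_def k_def by (rule norm_cauchy_schwarz)
    qed
    also have "\<dots> = norm z * integral {s..t} k" by (simp add: mult.commute)
    finally have "norm z * norm z \<le> norm z * integral {s..t} k" by (simp add: power2_eq_square)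
    moreover have "0 \<le> integral {s..t} k" using kt by (rule integral_nonneg) (simp add: k_def)
    ultimately show ?thesis unfolding z_def[symmetric] by (cases "z = 0") auto
  qed
  with k that[of k] show thesis by (simp add: k_def)
qed

text \<open>
  Fatou's lemma for forward difference quotients, which avoids the Lebesgue differentiation theorem.
\<close>

lemma nn_integral_antimono_derivative_le:
  fixes F g :: "real \<Rightarrow> real"
  assumes cont: "continuous_on {0..} F"
    and nonneg: "\<And>t. 0 \<le> t \<Longrightarrow> 0 \<le> F t"
    and anti: "\<And>s t. 0 \<le> s \<Longrightarrow> s \<le> t \<Longrightarrow> F t \<le> F s"
    and deriv: "AE t in lebesgue_on {0..}. (F has_real_derivative - g t) (at t within {0..})"
  shows "(\<integral>\<^sup>+t. ennreal (g t) \<partial>lebesgue_on {0..}) \<le> ennreal (F 0)"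
proof -
  define h where "h = (\<lambda>n::nat. 1 / real (Suc n))"
  have h: "0 < h n" for n by (simp add: h_def)
  have h_lim: "h \<longlonglongrightarrow> 0"
    unfolding h_def using LIMSEQ_inverse_real_of_nat by (simp add: inverse_eq_divide)
  \<comment> \<open>The cut-off at \<open>real n\<close> keeps every integral on a compact interval;
    for fixed \<open>t\<close> it equals 1 for all large \<open>n\<close> and does not affect the
    limit.\<close>
  define D where "D = (\<lambda>n t. indicator {0..real n} t * ((F t - F (t + h n)) / h n))"
  have shift_cont: "continuous_on {0..} (\<lambda>t. F (t + h n))" for n
  proof (rule continuous_on_compose2[OF cont])
    show "continuous_on {0..} (\<lambda>t. t + h n)" by (intro continuous_intros)
    show "(\<lambda>t. t + h n) ` {0..} \<subseteq> {0..}" using h[of n] by auto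
  qed
  have meas: "(\<lambda>t. ennreal (D n t)) \<in> borel_measurable (lebesgue_on {0..})" for n
  proof -
    have "(\<lambda>t. (F t - F (t + h n)) / h n) \<in> borel_measurable (lebesgue_on {0..})"
      using h[of n] by (intro continuous_imp_measurable_on_sets_lebesgue continuous_intros cont shift_cont) auto
    moreover have "indicator {0..real n} \<in> borel_measurable (lebesgue_on {0..})"
      by (intro measurable_restrict_space1 borel_measurable_indicator) auto
    ultimately have "D n \<in> borel_measurable (lebesgue_on {0..})"
      unfolding D_def by (rule borel_measurable_times[rotated])
    then show ?thesis by simp
  qed
  have lim: "AE t in lebesgue_on {0..}. ennreal (g t) \<le> liminf (\<lambda>n. ennreal (D n t))"
    using deriv
  proof (rule AE_mp, intro AE_I2 impI)
    fix t assume "t \<in> space (lebesgue_on {0..})" and d: "(F has_real_derivative - g t) (at t within {0..})"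
    then have t: "0 \<le> t" by simp
    have "filterlim (\<lambda>n. t + h n) (at t within {0..}) sequentially"
      unfolding filterlim_at using h t tendsto_add[OF tendsto_const[of t] h_lim]
      by (auto intro!: always_eventually add_nonneg_nonneg simp: less_imp_le less_imp_neq[symmetric])
    with d have "(\<lambda>n. (F (t + h n) - F t) / (t + h n - t)) \<longlonglongrightarrow> - g t"
      unfolding has_field_derivative_iff by (rule filterlim_compose)
    then have "(\<lambda>n. - ((F (t + h n) - F t) / h n)) \<longlonglongrightarrow> g t"
      using tendsto_minus by fastforce
    moreover have "\<forall>\<^sub>F n in sequentially. - ((F (t + h n) - F t) / h n) = D n t"
      using eventually_ge_at_top[of "nat \<lceil>t\<rceil>"]
    proof eventually_elim
      case (elim n)
      then have "t \<le> real n" by linarith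
      then show ?case using t by (simp add: D_def minus_divide_left)
    qed
    ultimately have "(\<lambda>n. D n t) \<longlonglongrightarrow> g t" by (rule Lim_transform_eventually)
    then have "(\<lambda>n. ennreal (D n t)) \<longlonglongrightarrow> ennreal (g t)" by (rule tendsto_ennrealI)
    then show "ennreal (g t) \<le> liminf (\<lambda>n. ennreal (D n t))"
      by (simp add: lim_imp_Liminf)
  qed
  have int: "(\<integral>\<^sup>+t. ennreal (D n t) \<partial>lebesgue_on {0..}) \<le> ennreal (F 0)" for n
  proof -
    define b where "b = real n"
    have b: "0 \<le> b" by (simp add: b_def)
    have Fi: "F integrable_on {c..d}" if "0 \<le> c" for c d
      using that by (intro integrable_continuous_real continuous_on_subset[OF cont]) auto
    have Fs: "(\<lambda>t. F (t + h n)) integrable_on {0..b}"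
      by (intro integrable_continuous_real continuous_on_subset[OF shift_cont]) auto
    have shift: "integral {0..b} (\<lambda>t. F (t + h n)) = integral {h n..b + h n} F"
      using integral_shift_Icc_real[of 0 b F "h n"] by (simp add: o_def add.commute)
    define I where "I = (integral {0..b} F - integral {h n..b + h n} F) / h n"
    have "((\<lambda>t. (F t - F (t + h n)) / h n) has_integral I) {0..b}"
      unfolding I_def shift[symmetric]
      by (intro has_integral_divide has_integral_diff integrable_integral Fi Fs) simp
    then have "integral\<^sup>N lborel (\<lambda>t. ennreal ((F t - F (t + h n)) / h n) * indicator {0..b} t) = ennreal I"
      using anti h[of n] by (intro nn_integral_has_integral_lebesgue') auto
    moreover have "(\<integral>\<^sup>+t. ennreal (D n t) \<partial>lebesgue_on {0..})
        = integral\<^sup>N lborel (\<lambda>t. ennreal ((F t - F (t + h n)) / h n) * indicator {0..b} t)"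
      by (subst nn_integral_restrict_space)
        (auto simp: nn_integral_completion D_def b_def indicator_def intro!: nn_integral_cong)
    \<comment> \<open>Shifting the window by \<open>h n\<close> leaves the integral over the first
      stretch minus the one over the last. The first is at most \<open>h n * F 0\<close> because
      \<open>F\<close> decreases, the last is nonnegative.\<close>
    moreover have "I \<le> F 0"
    proof -
      have "integral {0..h n} F + integral {h n..b + h n} F = integral {0..b + h n} F"
        using b h[of n] by (intro Henstock_Kurzweil_Integration.integral_combine Fi) auto
      moreover have "integral {0..b} F + integral {b..b + h n} F = integral {0..b + h n} F"
        using b h[of n] by (intro Henstock_Kurzweil_Integration.integral_combine Fi) auto
      moreover have "0 \<le> integral {b..b + h n} F"
        using b by (intro integral_nonneg Fi nonneg) auto
      moreover have "integral {0..h n} F \<le> integral {0..h n} (\<lambda>_. F 0)"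
        using anti by (intro integral_le Fi) auto
      ultimately have "integral {0..b} F - integral {h n..b + h n} F \<le> h n * F 0"
        using h[of n] by simp
      then show ?thesis unfolding I_def using h[of n] by (simp add: divide_le_eq mult.commute)
    qed
    ultimately show ?thesis by (simp add: ennreal_leI)
  qed
  have "(\<integral>\<^sup>+t. ennreal (g t) \<partial>lebesgue_on {0..}) \<le> (\<integral>\<^sup>+t. liminf (\<lambda>n. ennreal (D n t)) \<partial>lebesgue_on {0..})"
    using lim by (rule nn_integral_mono_AE)
  also have "\<dots> \<le> liminf (\<lambda>n. \<integral>\<^sup>+t. ennreal (D n t) \<partial>lebesgue_on {0..})"
    using meas by (rule nn_integral_liminf)
  also have "\<dots> \<le> liminf (\<lambda>n. ennreal (F 0))"
    using int by (intro Liminf_mono always_eventually allI)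
  also have "\<dots> = ennreal (F 0)" by (simp add: Liminf_const)
  finally show ?thesis .
qed

lemma antimono_nonneg_convergent:
  fixes f :: "real \<Rightarrow> real"
  assumes nonneg: "\<And>t. 0 \<le> t \<Longrightarrow> 0 \<le> f t"
    and anti: "\<And>s t. 0 \<le> s \<Longrightarrow> s \<le> t \<Longrightarrow> f t \<le> f s"
  shows "(f \<longlongrightarrow> Inf (f ` {0..})) at_top"
proof (rule decreasing_tendsto)
  have bdd: "bdd_below (f ` {0..})" using nonneg by (intro bdd_belowI[of _ 0]) auto
  show "\<forall>\<^sub>F t in at_top. Inf (f ` {0..}) \<le> f t"
    using eventually_ge_at_top[of 0] by eventually_elim (auto intro: cInf_lower bdd)
  fix c assume "Inf (f ` {0..}) < c"
  then obtain s where s: "0 \<le> s" "f s < c" using cInf_less_iff[OF _ bdd] by auto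
  show "\<forall>\<^sub>F t in at_top. f t < c"
    using eventually_ge_at_top[of s] by eventually_elim (use s anti in \<open>meson le_less_trans\<close>)
qed

section \<open>The flow of a nonexpansive map\<close>

lemma at_right_le_at_within_nonneg: "0 \<le> (t::real) \<Longrightarrow> at_right t \<le> at t within {0..}"
  by (rule at_le) auto

lemma at_within_nonneg_neq_bot: "0 \<le> (t::real) \<Longrightarrow> at t within {0..} \<noteq> bot"
  using at_right_le_at_within_nonneg[of t] trivial_limit_at_right_real[of t] by (auto simp: bot_unique)

lemma has_vector_derivative_right_expansion:
  assumes "(x has_vector_derivative v) (at t within {0..})" and t: "0 \<le> t" and e: "0 < e"
  shows "\<forall>\<^sub>F s in at_right t. norm (x s - x t - (s - t) *\<^sub>R v) \<le> e * (s - t)"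
proof -
  obtain d where d: "0 < d"
    "\<And>s. s \<in> {0..} \<Longrightarrow> norm (s - t) < d \<Longrightarrow> norm (x s - x t - (s - t) *\<^sub>R v) \<le> e * norm (s - t)"
    using assms unfolding has_vector_derivative_def has_derivative_within_alt by blast
  have "t < t + d" using d(1) by simp
  from eventually_at_right_real[OF this] show ?thesis
  proof eventually_elim
    case (elim s)
    then show ?case using d(2)[of s] t by auto
  qed
qed

locale nonexpansive_flow =
  fixes T :: "'a::{real_inner, complete_space} \<Rightarrow> 'a"
    and lam :: "real \<Rightarrow> real" and L :: real and x :: "real \<Rightarrow> 'a"
  assumes nonexpansive: "norm (T u - T v) \<le> norm (u - v)"
    and lam_measurable: "lam \<in> borel_measurable (lebesgue_on {0..})"
    and lam_bounds: "0 \<le> t \<Longrightarrow> 0 \<le> lam t \<and> lam t \<le> L"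
    and lac: "locally_absolutely_continuous x"
    and ode: "AE t in lebesgue_on {0..}.
      (x has_vector_derivative lam t *\<^sub>R (T (x t) - x t)) (at t within {0..})"
begin

definition residual :: "real \<Rightarrow> real" where
  "residual t = norm (T (x t) - x t)"

lemma residual_nonneg: "0 \<le> residual t"
  by (simp add: residual_def)

lemma L_nonneg: "0 \<le> L"
  using lam_bounds[of 0] by simp

section \<open>From the almost everywhere equation to monotone quantities of the flow\<close>

lemma ode_off_negligible:
  obtains N where "negligible N"
    "\<And>t. 0 \<le> t \<Longrightarrow> t \<notin> N \<Longrightarrow> (x has_vector_derivative lam t *\<^sub>R (T (x t) - x t)) (at t within {0..})"
proof -
  have "AE t in lebesgue. t \<in> {0..} \<longrightarrow>
      (x has_vector_derivative lam t *\<^sub>R (T (x t) - x t)) (at t within {0..})"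
    using ode by (subst (asm) AE_restrict_space_iff) auto
  then obtain N where "N \<in> null_sets lebesgue"
    "{t. \<not> (t \<in> {0..} \<longrightarrow> (x has_vector_derivative lam t *\<^sub>R (T (x t) - x t)) (at t within {0..}))} \<subseteq> N"
    unfolding eventually_ae_filter by auto
  then show thesis by (intro that[of N]) (auto simp: negligible_iff_null_sets)
qed

text \<open>A function that is \<open>D\<close>-Lipschitz in the position inherits the integrable
  modulus of \<open>x\<close>. Its local behaviour need only be checked where \<open>x\<close> has a
  first-order expansion with the velocity of the equation, so the null set is not seen by later
  arguments.\<close>

lemma Dini_bound:
  fixes f :: "real \<Rightarrow> real"
  assumes ab: "0 \<le> a" "a \<le> b" and C: "0 \<le> C" and D: "0 \<le> D"
    and lip: "\<And>s t. a \<le> s \<Longrightarrow> s \<le> t \<Longrightarrow> t \<le> b \<Longrightarrow> \<bar>f t - f s\<bar> \<le> D * norm (x t - x s)"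
    and Dini: "\<And>t e. a \<le> t \<Longrightarrow> t < b \<Longrightarrow> 0 < e \<Longrightarrow>
      (\<And>e'. 0 < e' \<Longrightarrow> \<forall>\<^sub>F s in at_right t.
        norm (x s - x t - (s - t) *\<^sub>R (lam t *\<^sub>R (T (x t) - x t))) \<le> e' * (s - t)) \<Longrightarrow>
      \<forall>\<^sub>F s in at_right t. f s - f t \<le> (C + e) * (s - t)"
  shows "f b \<le> f a + C * (b - a)"
proof -
  have "0 < b + 1" using ab by simp
  then obtain k where k: "k absolutely_integrable_on {0..b + 1}" "\<And>t. 0 \<le> k t"
    "\<And>s t. 0 \<le> s \<Longrightarrow> s \<le> t \<Longrightarrow> t \<le> b + 1 \<Longrightarrow> norm (x t - x s) \<le> integral {s..t} k"
    using locally_absolutely_continuous_bound[OF lac] by blast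
  have kab: "k absolutely_integrable_on {a..b}"
    using k(1) by (rule absolutely_integrable_on_subinterval) (use ab in auto)
  obtain N where N: "negligible N"
    "\<And>t. 0 \<le> t \<Longrightarrow> t \<notin> N \<Longrightarrow> (x has_vector_derivative lam t *\<^sub>R (T (x t) - x t)) (at t within {0..})"
    using ode_off_negligible by blast
  show ?thesis
  proof (rule AE_Dini_bound[OF ab(2), where k = "\<lambda>t. D * k t" and N = N])
    show "(\<lambda>t. D * k t) absolutely_integrable_on {a..b}"
      using kab by (rule set_integrable_mult_right)
    show "0 \<le> D * k t" for t using D k(2) by simp
    show "\<bar>f t - f s\<bar> \<le> integral {s..t} (\<lambda>t. D * k t)" if "a \<le> s" "s \<le> t" "t \<le> b" for s t
    proof -
      have "\<bar>f t - f s\<bar> \<le> D * norm (x t - x s)" by (rule lip[OF that])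
      also have "\<dots> \<le> D * integral {s..t} k"
        using k(3)[of s t] that ab by (intro mult_left_mono D) auto
      finally show ?thesis by simp
    qed
    show "\<forall>\<^sub>F s in at_right t. f s - f t \<le> (C + e) * (s - t)"
      if "a \<le> t" "t < b" "t \<notin> N" "0 < e" for t e
      using that ab by (intro Dini has_vector_derivative_right_expansion N(2)) auto
  qed (use C N in auto)
qed

text \<open>Makes the Euler step a convex combination of \<open>x t\<close> and
  \<open>T (x t)\<close> even when \<open>lam t\<close> exceeds 1.\<close>

lemma step_eventually_small: "\<forall>\<^sub>F s in at_right t. t < s \<and> (s - t) * lam t \<le> 1"
proof -
  have "((\<lambda>s. (s - t) * lam t) \<longlongrightarrow> (t - t) * lam t) (at_right t)"
    by (intro tendsto_intros)
  then have "\<forall>\<^sub>F s in at_right t. (s - t) * lam t < 1"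
    by (rule order_tendstoD) simp
  moreover have "\<forall>\<^sub>F s in at_right t. t < s" by (simp add: eventually_at_right_less)
  ultimately show ?thesis by eventually_elim simp
qed

text \<open>Up to first-order error the flow moves to a convex combination of \<open>x r\<close> and
  \<open>T (x r)\<close>, and \<open>T (x r)\<close> is no farther from \<open>y\<close> than
  \<open>x r\<close> is.\<close>

lemma norm_diff_fixpoint_antimono:
  assumes y: "T y = y" and st: "0 \<le> s" "s \<le> t"
  shows "norm (x t - y) \<le> norm (x s - y)"
proof -
  have "norm (x t - y) \<le> norm (x s - y) + 0 * (t - s)"
  proof (rule Dini_bound[OF st, where D = 1])
    show "\<bar>norm (x r - y) - norm (x q - y)\<bar> \<le> 1 * norm (x r - x q)" for q r
      using norm_triangle_ineq3[of "x r - y" "x q - y"] by simp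
  next
    fix r e :: real
    assume r: "s \<le> r" "0 < e" and exp: "\<And>e'. 0 < e' \<Longrightarrow> \<forall>\<^sub>F q in at_right r.
        norm (x q - x r - (q - r) *\<^sub>R (lam r *\<^sub>R (T (x r) - x r))) \<le> e' * (q - r)"
    show "\<forall>\<^sub>F q in at_right r. norm (x q - y) - norm (x r - y) \<le> (0 + e) * (q - r)"
      using exp[OF r(2)] step_eventually_small[of r]
    proof eventually_elim
      case (elim q)
      define c where "c = (q - r) * lam r"
      have c: "0 \<le> c" "c \<le> 1" using elim lam_bounds[of r] r st by (auto simp: c_def)
      have "x q - y = (x q - x r - (q - r) *\<^sub>R (lam r *\<^sub>R (T (x r) - x r))) + ((1 - c) *\<^sub>R (x r - y) + c *\<^sub>R (T (x r) - T y))"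
        by (simp add: c_def y algebra_simps)
      then have "norm (x q - y) \<le> norm (x q - x r - (q - r) *\<^sub>R (lam r *\<^sub>R (T (x r) - x r))) + (norm ((1 - c) *\<^sub>R (x r - y)) + norm (c *\<^sub>R (T (x r) - T y)))"
        by (metis norm_triangle_ineq norm_triangle_le add_left_mono)
      also have "\<dots> \<le> e * (q - r) + ((1 - c) * norm (x r - y) + c * norm (x r - y))"
        using elim c nonexpansive[of "x r" y] by (intro add_mono) (auto intro: mult_left_mono)
      finally show ?case by (simp add: algebra_simps)
    qed
  qed auto
  then show ?thesis by simp
qed

text \<open>An Euler step with coefficient \<open>c\<close> shrinks \<open>T x - x\<close> by the
  factor \<open>1 - c\<close>, while the value of \<open>T\<close> moves by at most \<open>c\<close>
  times the residual; the two effects balance. The constant \<open>D = 2\<close> is the Lipschitz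
  constant of \<open>T - id\<close>.\<close>

lemma residual_antimono:
  assumes st: "0 \<le> s" "s \<le> t"
  shows "residual t \<le> residual s"
proof -
  have "residual t \<le> residual s + 0 * (t - s)"
  proof (rule Dini_bound[OF st, where D = 2])
    show "\<bar>residual r - residual q\<bar> \<le> 2 * norm (x r - x q)" for q r
    proof -
      have "\<bar>residual r - residual q\<bar> \<le> norm ((T (x r) - x r) - (T (x q) - x q))"
        unfolding residual_def by (rule norm_triangle_ineq3)
      also have "\<dots> = norm ((T (x r) - T (x q)) - (x r - x q))" by (simp add: algebra_simps)
      also have "\<dots> \<le> norm (T (x r) - T (x q)) + norm (x r - x q)" by (rule norm_triangle_ineq4)
      finally show ?thesis using nonexpansive[of "x r" "x q"] by simp
    qed
  next
    fix r e :: real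
    assume r: "s \<le> r" "0 < e" and exp: "\<And>e'. 0 < e' \<Longrightarrow> \<forall>\<^sub>F q in at_right r.
        norm (x q - x r - (q - r) *\<^sub>R (lam r *\<^sub>R (T (x r) - x r))) \<le> e' * (q - r)"
    \<comment> \<open>The expansion error \<open>w\<close> enters twice: in the displacement of
      \<open>x\<close> and directly in the new residual.\<close>
    have "0 < e / 2" using r by simp
    from exp[OF this] step_eventually_small[of r]
    show "\<forall>\<^sub>F q in at_right r. residual q - residual r \<le> (0 + e) * (q - r)"
    proof eventually_elim
      case (elim q)
      define c where "c = (q - r) * lam r"
      have c: "0 \<le> c" "c \<le> 1" using elim lam_bounds[of r] r st by (auto simp: c_def)
      define w where "w = x q - x r - (q - r) *\<^sub>R (lam r *\<^sub>R (T (x r) - x r))"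
      have w: "norm w \<le> e / 2 * (q - r)" using elim by (simp add: w_def)
      have xqr: "x q - x r = w + c *\<^sub>R (T (x r) - x r)" by (simp add: w_def c_def)
      have step: "norm (x q - x r) \<le> e / 2 * (q - r) + c * residual r"
        using norm_triangle_ineq[of w "c *\<^sub>R (T (x r) - x r)"] w c by (simp add: xqr residual_def)
      have "T (x q) - x q = (T (x q) - T (x r)) + ((1 - c) *\<^sub>R (T (x r) - x r) - w)"
        using xqr by (simp add: algebra_simps)
      then have "residual q \<le> norm (T (x q) - T (x r)) + norm ((1 - c) *\<^sub>R (T (x r) - x r) - w)"
        unfolding residual_def by (metis norm_triangle_ineq)
      also have "\<dots> \<le> norm (x q - x r) + (norm ((1 - c) *\<^sub>R (T (x r) - x r)) + norm w)"
        by (intro add_mono nonexpansive norm_triangle_ineq4)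
      also have "\<dots> \<le> (e / 2 * (q - r) + c * residual r) + ((1 - c) * residual r + e / 2 * (q - r))"
        using step w c by (intro add_mono) (auto simp: residual_def)
      also have "\<dots> = residual r + e * (q - r)" by (simp add: algebra_simps)
      finally show ?case by simp
    qed
  qed auto
  then show ?thesis by simp
qed

text \<open>The speed after time \<open>s\<close> is at most \<open>L\<close> times the current
  residual, hence at most \<open>L * residual s\<close> by monotonicity.\<close>

lemma norm_diff_le_residual:
  assumes st: "0 \<le> s" "s \<le> t"
  shows "norm (x t - x s) \<le> L * residual s * (t - s)"
proof -
  have "norm (x t - x s) \<le> norm (x s - x s) + L * residual s * (t - s)"
  proof (rule Dini_bound[OF st, where D = 1])
    show "0 \<le> L * residual s" using L_nonneg residual_nonneg by simp
    show "\<bar>norm (x r - x s) - norm (x q - x s)\<bar> \<le> 1 * norm (x r - x q)" for q r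
      using norm_triangle_ineq3[of "x r - x s" "x q - x s"] by simp
  next
    fix r e :: real
    assume r: "s \<le> r" "0 < e" and exp: "\<And>e'. 0 < e' \<Longrightarrow> \<forall>\<^sub>F q in at_right r.
        norm (x q - x r - (q - r) *\<^sub>R (lam r *\<^sub>R (T (x r) - x r))) \<le> e' * (q - r)"
    show "\<forall>\<^sub>F q in at_right r. norm (x q - x s) - norm (x r - x s) \<le> (L * residual s + e) * (q - r)"
      using exp[OF r(2)] step_eventually_small[of r]
    proof eventually_elim
      case (elim q)
      have "norm (x q - x s) - norm (x r - x s) \<le> norm (x q - x r)"
        using norm_triangle_ineq2[of "x q - x s" "x r - x s"] by simp
      also have "\<dots> \<le> norm (x q - x r - (q - r) *\<^sub>R (lam r *\<^sub>R (T (x r) - x r))) + norm ((q - r) *\<^sub>R (lam r *\<^sub>R (T (x r) - x r)))"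
        by (metis diff_add_cancel norm_triangle_ineq)
      also have "\<dots> \<le> e * (q - r) + (q - r) * (L * residual s)"
      proof (intro add_mono)
        have "lam r * residual r \<le> L * residual s"
          using lam_bounds[of r] residual_antimono[of s r] r st residual_nonneg L_nonneg
          by (intro mult_mono) auto
        then show "norm ((q - r) *\<^sub>R (lam r *\<^sub>R (T (x r) - x r))) \<le> (q - r) * (L * residual s)"
          using elim lam_bounds[of r] r st by (auto simp: residual_def[symmetric] intro!: mult_left_mono)
      qed (use elim in auto)
      finally show ?case by (simp add: algebra_simps)
    qed
  qed auto
  then show ?thesis by simp
qed

text \<open>The limit of the derivative is claimed over all times where it exists, including those
  in the null set where the equation may fail. The bound is therefore read off from increments of
  \<open>x\<close> instead of the equation.\<close>

lemma norm_derivative_le_residual: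
  assumes d: "(x has_vector_derivative v) (at t within {0..})" and t: "0 \<le> t"
  shows "norm v \<le> L * residual t"
proof (rule field_le_epsilon)
  fix e :: real assume "0 < e"
  from has_vector_derivative_right_expansion[OF d t this] eventually_at_right_less[of t]
  have "\<forall>\<^sub>F s in at_right t. norm v \<le> L * residual t + e"
  proof eventually_elim
    case (elim s)
    have "(s - t) * norm v = norm ((s - t) *\<^sub>R v)" using elim by simp
    also have "\<dots> \<le> norm (x s - x t) + norm (x s - x t - (s - t) *\<^sub>R v)"
      using norm_triangle_ineq4[of "x s - x t" "x s - x t - (s - t) *\<^sub>R v"] by simp
    also have "\<dots> \<le> L * residual t * (s - t) + e * (s - t)"
      using elim t by (intro add_mono norm_diff_le_residual) auto
    finally have "(s - t) * norm v \<le> (s - t) * (L * residual t + e)" by (simp add: algebra_simps)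
    then show ?case using elim by simp
  qed
  then show "norm v \<le> L * residual t + e"
    by (auto dest: eventually_happens'[rotated] simp: trivial_limit_at_right_real)
qed

section \<open>Continuity and the energy estimate\<close>

lemma continuous_trajectory: "continuous_on {0..} x"
proof -
  have le: "norm (x t - x s) \<le> L * residual 0 * \<bar>t - s\<bar>" if "0 \<le> s" "s \<le> t" for s t
  proof -
    have "norm (x t - x s) \<le> L * residual s * (t - s)" by (rule norm_diff_le_residual[OF that])
    also have "\<dots> \<le> L * residual 0 * (t - s)"
      using that L_nonneg residual_antimono[of 0 s] by (intro mult_right_mono mult_left_mono) auto
    finally show ?thesis using that by simp
  qed
  have "(L * residual 0)-lipschitz_on {0..} x"
  proof (rule lipschitz_onI)
    fix s t :: real assume "s \<in> {0..}" "t \<in> {0..}"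
    then show "dist (x s) (x t) \<le> L * residual 0 * dist s t"
      using le[of s t] le[of t s] by (cases "s \<le> t") (auto simp: dist_norm norm_minus_commute abs_minus_commute)
  qed (use L_nonneg residual_nonneg in simp)
  then show ?thesis by (rule lipschitz_on_continuous_on)
qed

lemma continuous_residual: "continuous_on {0..} residual"
proof -
  have "1-lipschitz_on UNIV T"
    by (rule lipschitz_onI) (simp_all add: dist_norm nonexpansive)
  then have "continuous_on UNIV T" by (rule lipschitz_on_continuous_on)
  then have "continuous_on {0..} (\<lambda>t. T (x t))"
    by (rule continuous_on_compose2[OF _ continuous_trajectory]) simp
  then show ?thesis
    unfolding residual_def[abs_def] by (intro continuous_intros continuous_trajectory)
qed

text \<open>Write \<open>T u - y\<close> as \<open>(T u - u) + (u - y)\<close> and expand the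
  square. This is the dissipation rate of the squared distance to a fixed point.\<close>

lemma nonexpansive_descent:
  assumes y: "T y = y"
  shows "(norm (T u - u))\<^sup>2 \<le> - 2 * inner (T u - u) (u - y)"
proof -
  have "(norm (p + q))\<^sup>2 = (norm p)\<^sup>2 + 2 * inner p q + (norm q)\<^sup>2" for p q :: 'a
    by (simp add: power2_norm_eq_inner inner_add_left inner_add_right inner_commute)
  from this[of "T u - u" "u - y"]
  have "(norm (T u - T y))\<^sup>2 = (norm (T u - u))\<^sup>2 + 2 * inner (T u - u) (u - y) + (norm (u - y))\<^sup>2"
    by (simp add: y)
  moreover have "(norm (T u - T y))\<^sup>2 \<le> (norm (u - y))\<^sup>2"
    using nonexpansive by (intro power_mono) auto
  ultimately show ?thesis by simp
qed

text \<open>The squared distance to \<open>y\<close> acts as a Lyapunov function: it is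
  nonincreasing and nonnegative, so its total dissipation is at most its initial value.\<close>

lemma residual_integral_bound:
  assumes y: "T y = y"
  shows "(\<integral>\<^sup>+t. ennreal (lam t * (residual t)\<^sup>2) \<partial>lebesgue_on {0..}) \<le> ennreal ((norm (x 0 - y))\<^sup>2)"
proof -
  define F where "F = (\<lambda>t. (norm (x t - y))\<^sup>2)"
  define g where "g = (\<lambda>t. - 2 * lam t * inner (T (x t) - x t) (x t - y))"
  have "(\<integral>\<^sup>+t. ennreal (lam t * (residual t)\<^sup>2) \<partial>lebesgue_on {0..}) \<le> (\<integral>\<^sup>+t. ennreal (g t) \<partial>lebesgue_on {0..})"
  proof (intro nn_integral_mono ennreal_leI)
    fix t :: real assume "t \<in> space (lebesgue_on {0..})"
    then have "lam t * (residual t)\<^sup>2 \<le> lam t * (- 2 * inner (T (x t) - x t) (x t - y))"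
      unfolding residual_def using lam_bounds[of t] by (intro mult_left_mono nonexpansive_descent y) auto
    then show "lam t * (residual t)\<^sup>2 \<le> g t" by (simp add: g_def)
  qed
  also have "\<dots> \<le> ennreal (F 0)"
  proof (rule nn_integral_antimono_derivative_le)
    show "continuous_on {0..} F"
      unfolding F_def by (intro continuous_intros continuous_trajectory)
    show "F t \<le> F s" if "0 \<le> s" "s \<le> t" for s t
      unfolding F_def using norm_diff_fixpoint_antimono[OF y that] by (intro power_mono) auto
    show "AE t in lebesgue_on {0..}. (F has_real_derivative - g t) (at t within {0..})"
      using ode
    proof (rule AE_mp, intro AE_I2 impI)
      fix t assume d: "(x has_vector_derivative lam t *\<^sub>R (T (x t) - x t)) (at t within {0..})"
      define v where "v = lam t *\<^sub>R (T (x t) - x t)"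
      have "((\<lambda>s. x s - y) has_derivative (\<lambda>h. h *\<^sub>R v)) (at t within {0..})"
        using d unfolding has_vector_derivative_def v_def by (auto intro!: derivative_eq_intros)
      then have "((\<lambda>s. inner (x s - y) (x s - y)) has_derivative
          (\<lambda>h. inner (x t - y) (h *\<^sub>R v) + inner (h *\<^sub>R v) (x t - y))) (at t within {0..})"
        by (intro has_derivative_inner)
      moreover have "(\<lambda>h. inner (x t - y) (h *\<^sub>R v) + inner (h *\<^sub>R v) (x t - y)) = (*) (- g t)"
        by (auto simp: fun_eq_iff g_def v_def inner_commute)
      ultimately show "(F has_real_derivative - g t) (at t within {0..})"
        by (simp add: has_field_derivative_def F_def power2_norm_eq_inner)
    qed
  qed (simp add: F_def)
  finally show ?thesis by (simp add: F_def)
qed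

section \<open>Integrability and asymptotics of the flow\<close>

lemma residual_tendsto_0:
  assumes y: "T y = y" and inf: "(\<integral>\<^sup>+t. ennreal (lam t) \<partial>lebesgue_on {0..}) = \<infinity>"
  shows "(residual \<longlongrightarrow> 0) at_top"
proof -
  define c where "c = Inf (residual ` {0..})"
  have lim: "(residual \<longlongrightarrow> c) at_top"
    unfolding c_def by (rule antimono_nonneg_convergent) (auto intro: residual_nonneg residual_antimono)
  have c0: "0 \<le> c" unfolding c_def by (rule cInf_greatest) (auto intro: residual_nonneg)
  have c_le: "c \<le> residual t" if "0 \<le> t" for t
    unfolding c_def using that by (intro cInf_lower bdd_belowI[of _ 0]) (auto intro: residual_nonneg)
  have meas: "(\<lambda>t. ennreal (lam t)) \<in> borel_measurable (lebesgue_on {0..})"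
    using lam_measurable by simp
  \<comment> \<open>A positive limit \<open>c\<close> of the decreasing residual would make the
    finite energy integral dominate c^2 times the infinite integral of \<open>lam\<close>.\<close>
  have "ennreal (c\<^sup>2) * \<infinity> = (\<integral>\<^sup>+t. ennreal (c\<^sup>2) * ennreal (lam t) \<partial>lebesgue_on {0..})"
    unfolding inf[symmetric] using meas by (rule nn_integral_cmult[symmetric])
  also have "\<dots> \<le> (\<integral>\<^sup>+t. ennreal (lam t * (residual t)\<^sup>2) \<partial>lebesgue_on {0..})"
  proof (rule nn_integral_mono)
    fix t :: real assume "t \<in> space (lebesgue_on {0..})"
    then have t: "0 \<le> t" by simp
    have "c\<^sup>2 * lam t \<le> (residual t)\<^sup>2 * lam t"
      using c_le[OF t] c0 lam_bounds[OF t] by (intro mult_right_mono power_mono) auto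
    then show "ennreal (c\<^sup>2) * ennreal (lam t) \<le> ennreal (lam t * (residual t)\<^sup>2)"
      using lam_bounds[OF t] by (simp add: ennreal_mult[symmetric] ennreal_leI mult.commute)
  qed
  also have "\<dots> \<le> ennreal ((norm (x 0 - y))\<^sup>2)" by (rule residual_integral_bound[OF y])
  also have "\<dots> < \<infinity>" by simp
  finally have "ennreal (c\<^sup>2) * \<infinity> < \<infinity>" .
  then have "c = 0" by (cases "c = 0") (auto simp: ennreal_mult_top)
  with lim show ?thesis by simp
qed

text \<open>Off a null set the integrand is lam^2 residual^2, whose measurability is a matter of
  real functions only; it is at most \<open>L\<close> times the integrand of the energy
  estimate.\<close>

lemma derivative_square_integrable:
  assumes y: "T y = y"
  shows "integrable (lebesgue_on {0..}) (\<lambda>t. (norm (vector_derivative x (at t within {0..})))\<^sup>2)"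
proof -
  define f where "f = (\<lambda>t. (lam t)\<^sup>2 * (residual t)\<^sup>2)"
  have resm: "residual \<in> borel_measurable (lebesgue_on {0..})"
    by (rule continuous_imp_measurable_on_sets_lebesgue[OF continuous_residual]) auto
  have "(\<integral>\<^sup>+t. ennreal (f t) \<partial>lebesgue_on {0..}) \<le> (\<integral>\<^sup>+t. ennreal L * ennreal (lam t * (residual t)\<^sup>2) \<partial>lebesgue_on {0..})"
  proof (rule nn_integral_mono)
    fix t :: real assume "t \<in> space (lebesgue_on {0..})"
    then have t: "0 \<le> lam t" "lam t \<le> L" using lam_bounds[of t] by auto
    then have "lam t * (lam t * (residual t)\<^sup>2) \<le> L * (lam t * (residual t)\<^sup>2)"
      by (intro mult_right_mono) auto
    then show "ennreal (f t) \<le> ennreal L * ennreal (lam t * (residual t)\<^sup>2)"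
      using t L_nonneg by (simp add: f_def ennreal_mult[symmetric] ennreal_leI power2_eq_square mult.assoc)
  qed
  also have "\<dots> = ennreal L * (\<integral>\<^sup>+t. ennreal (lam t * (residual t)\<^sup>2) \<partial>lebesgue_on {0..})"
    using lam_measurable resm by (intro nn_integral_cmult) simp
  also have "\<dots> < \<infinity>"
    using residual_integral_bound[OF y] by (auto intro: ennreal_mult_less_top[THEN iffD2] le_less_trans simp: ennreal_mult_less_top)
  finally have "integrable (lebesgue_on {0..}) f"
    using lam_measurable resm by (simp add: integrable_iff_bounded f_def)
  then have f: "f absolutely_integrable_on {0..}"
    by (simp add: set_integrable_def integrable_restrict_space)
  obtain N where N: "negligible N"
    "\<And>t. 0 \<le> t \<Longrightarrow> t \<notin> N \<Longrightarrow> (x has_vector_derivative lam t *\<^sub>R (T (x t) - x t)) (at t within {0..})"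
    using ode_off_negligible by blast
  have "(\<lambda>t. (norm (vector_derivative x (at t within {0..})))\<^sup>2) absolutely_integrable_on {0..}"
  proof (rule absolutely_integrable_spike[OF f N(1)])
    fix t :: real assume "t \<in> {0..} - N"
    then have "vector_derivative x (at t within {0..}) = lam t *\<^sub>R (T (x t) - x t)"
      using N(2)[of t] by (intro vector_derivative_within at_within_nonneg_neq_bot) auto
    then show "(norm (vector_derivative x (at t within {0..})))\<^sup>2 = f t"
      by (simp add: f_def residual_def power_mult_distrib)
  qed
  then show ?thesis by (simp add: set_integrable_def integrable_restrict_space)
qed

lemma derivative_tendsto_0:
  assumes "(residual \<longlongrightarrow> 0) at_top"
  shows "((\<lambda>t. vector_derivative x (at t within {0..})) \<longlongrightarrow> 0)
    (inf at_top (principal {t. t \<ge> 0 \<and> x differentiable (at t within {0..})}))"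
proof (rule Lim_null_comparison)
  have "((\<lambda>t. L * residual t) \<longlongrightarrow> L * 0) at_top" by (intro tendsto_intros assms)
  then show "((\<lambda>t. L * residual t) \<longlongrightarrow> 0) (inf at_top (principal {t. t \<ge> 0 \<and> x differentiable (at t within {0..})}))"
    by (intro tendsto_mono[OF inf_le1]) simp
  show "\<forall>\<^sub>F t in inf at_top (principal {t. t \<ge> 0 \<and> x differentiable (at t within {0..})}).
      norm (vector_derivative x (at t within {0..})) \<le> L * residual t"
    unfolding eventually_inf_principal
    by (intro always_eventually allI impI norm_derivative_le_residual) (auto simp: vector_derivative_works)
qed

lemma bounded_trajectory:
  assumes y: "T y = y" and t: "0 \<le> t"
  shows "norm (x t) \<le> norm (x 0 - y) + norm y"
  using norm_diff_fixpoint_antimono[OF y _ t] norm_triangle_ineq[of "x t - y" y] by simp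

lemma weakly_convergent_to_fixpoint:
  assumes y: "T y = y" and res: "(residual \<longlongrightarrow> 0) at_top"
  shows "\<exists>p. T p = p \<and> weakly_tendsto x p at_top"
proof -
  have bdd: "\<forall>\<^sub>F t in at_top. norm (x t) \<le> norm (x 0 - y) + norm y"
    using eventually_ge_at_top[of 0] by eventually_elim (rule bounded_trajectory[OF y])
  have lim: "((\<lambda>t. T (x t) - x t) \<longlongrightarrow> 0) at_top"
    using res unfolding residual_def[abs_def] by (rule tendsto_norm_zero_cancel)
  have "\<exists>p\<in>{p. T p = p}. weakly_tendsto x p at_top"
  proof (rule Opial[OF _ bdd])
    fix z assume "z \<in> {p. T p = p}"
    then have "((\<lambda>t. norm (x t - z)) \<longlongrightarrow> Inf ((\<lambda>t. norm (x t - z)) ` {0..})) at_top"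
      by (intro antimono_nonneg_convergent norm_diff_fixpoint_antimono) auto
    then show "\<exists>l. ((\<lambda>t. norm (x t - z)) \<longlongrightarrow> l) at_top" by blast
  next
    fix G p assume G: "G \<le> at_top" "G \<noteq> bot" "weakly_tendsto x p G"
    have "T p = p"
      using demiclosed_nonexpansive[OF nonexpansive G(3,2)] filter_leD[OF G(1) bdd] tendsto_mono[OF G(1) lim] by blast
    then show "p \<in> {p. T p = p}" by simp
  qed simp
  then show ?thesis by blast
qed

end

section \<open>The forward-backward operator\<close>

lemma emeasure_lborel_half_line: "emeasure lborel {0::real..} = \<infinity>"
proof (rule ccontr)
  assume "emeasure lborel {0::real..} \<noteq> \<infinity>"
  then obtain r where r: "emeasure lborel {0::real..} = ennreal r" "0 \<le> r"
    by (cases "emeasure lborel {0::real..}") auto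
  have "emeasure lborel {0..r + 1} \<le> emeasure lborel {0::real..}"
    by (intro emeasure_mono) auto
  then show False using r by simp
qed

text \<open>Monotonicity at the two graph points over \<open>p\<close> and \<open>q\<close> gives
  firm nonexpansiveness, |p - q|^2 \<le> \<open>inner (p - q) (u - v)\<close>; Cauchy-Schwarz does
  the rest.\<close>

lemma resolvent_nonexpansive:
  fixes A :: "'a::{real_inner, complete_space} set_operator"
  assumes A: "maximally_monotone_op A" and \<gamma>: "0 < \<gamma>"
  shows "norm (resolvent (op_scaleR \<gamma> A) u - resolvent (op_scaleR \<gamma> A) v) \<le> norm (u - v)"
proof -
  define p q where "p = resolvent (op_scaleR \<gamma> A) u" and "q = resolvent (op_scaleR \<gamma> A) v"
  have "(1 / \<gamma>) *\<^sub>R (u - p) \<in> A p" "(1 / \<gamma>) *\<^sub>R (v - q) \<in> A q"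
    using resolvent_eq_iff[OF A \<gamma>] by (auto simp: p_def q_def)
  moreover have "monotone_op A" using A by (simp add: maximally_monotone_op_def)
  ultimately have "0 \<le> inner (p - q) ((1 / \<gamma>) *\<^sub>R (u - p) - (1 / \<gamma>) *\<^sub>R (v - q))"
    by (intro monotone_opD)
  also have "\<dots> = (inner (p - q) (u - v) - (norm (p - q))\<^sup>2) / \<gamma>"
    by (simp add: power2_norm_eq_inner inner_diff_left inner_diff_right diff_divide_distrib add_divide_distrib)
  finally have "(norm (p - q))\<^sup>2 \<le> inner (p - q) (u - v)" using \<gamma> by (simp add: zero_le_divide_iff)
  also have "\<dots> \<le> norm (p - q) * norm (u - v)" by (rule norm_cauchy_schwarz)
  finally show ?thesis
    unfolding p_def[symmetric] q_def[symmetric] power2_eq_square by (cases "p = q") auto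
qed

text \<open>The squared norm changes by \<gamma> (\<gamma> |b|^2 - 2
  \<open>inner (u - v) b\<close>). Cocoercivity makes the bracket nonpositive exactly under the step
  bound 2 \<beta>.\<close>

lemma cocoercive_forward_step_nonexpansive:
  assumes B: "cocoercive \<beta> B" and \<gamma>: "0 < \<gamma>" "\<gamma> \<le> 2 * \<beta>"
  shows "norm ((u - \<gamma> *\<^sub>R B u) - (v - \<gamma> *\<^sub>R B v)) \<le> norm (u - v)"
proof -
  define b where "b = B u - B v"
  have "\<gamma> * (norm b)\<^sup>2 \<le> 2 * \<beta> * (norm b)\<^sup>2" using \<gamma> by (intro mult_right_mono) auto
  also have "\<dots> \<le> 2 * inner (u - v) b" using B by (simp add: cocoercive_def b_def)
  finally have "\<gamma> * (\<gamma> * (norm b)\<^sup>2) \<le> \<gamma> * (2 * inner (u - v) b)" using \<gamma> by (intro mult_left_mono) auto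
  moreover have "(norm ((u - v) - \<gamma> *\<^sub>R b))\<^sup>2 = (norm (u - v))\<^sup>2 - \<gamma> * (2 * inner (u - v) b) + \<gamma> * (\<gamma> * (norm b)\<^sup>2)"
    by (simp add: power2_norm_eq_inner inner_diff_left inner_diff_right inner_commute algebra_simps)
  ultimately have "(norm ((u - v) - \<gamma> *\<^sub>R b))\<^sup>2 \<le> (norm (u - v))\<^sup>2" by simp
  then have "norm ((u - v) - \<gamma> *\<^sub>R b) \<le> norm (u - v)" by (rule power2_le_imp_le) simp
  then show ?thesis by (simp add: b_def algebra_simps)
qed

lemma zer_iff_fixpoint:
  fixes A :: "'a::{real_inner, complete_space} set_operator"
  assumes A: "maximally_monotone_op A" and \<gamma>: "0 < \<gamma>"
  shows "y \<in> op_zer (op_add A (op_of_fun B)) \<longleftrightarrow> resolvent (op_scaleR \<gamma> A) (y - \<gamma> *\<^sub>R B y) = y"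
    and "y \<in> op_zer (op_add A (op_of_fun B)) \<longleftrightarrow> - B y \<in> A y"
proof -
  have "0 = u + B y \<longleftrightarrow> u = - B y" for u by (metis add_eq_0_iff2)
  then show "y \<in> op_zer (op_add A (op_of_fun B)) \<longleftrightarrow> - B y \<in> A y"
    by (auto simp: op_zer_def op_add_def op_of_fun_def)
  then show "y \<in> op_zer (op_add A (op_of_fun B)) \<longleftrightarrow> resolvent (op_scaleR \<gamma> A) (y - \<gamma> *\<^sub>R B y) = y"
    unfolding resolvent_eq_iff[OF A \<gamma>] using \<gamma> by simp
qed

text \<open>The modulus may be discontinuous or infinite, so it is not inverted. Its positive value
  at \<open>e\<close> serves as a threshold: once the scalar product is below it, monotonicity of
  the modulus keeps the distance below \<open>e\<close>.\<close>

lemma uniformly_monotone_tendsto: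
  assumes A: "uniformly_monotone_op A"
    and mem: "\<And>t. u t \<in> A (p t)" "v \<in> A y"
    and lim: "((\<lambda>t. inner (p t - y) (u t - v)) \<longlongrightarrow> 0) F"
  shows "(p \<longlongrightarrow> y) F"
proof (rule tendstoI)
  obtain \<phi> :: "real \<Rightarrow> ereal" where \<phi>: "\<forall>t\<ge>0. \<phi> t \<ge> 0" "mono_on {0..} \<phi>"
    "\<forall>t\<ge>0. \<phi> t = 0 \<longleftrightarrow> t = 0"
    "\<forall>(x, u) \<in> op_graph A. \<forall>(y, v) \<in> op_graph A. \<phi> (norm (x - y)) \<le> ereal (inner (x - y) (u - v))"
    using A unfolding uniformly_monotone_op_def by blast
  have \<phi>_le: "\<phi> (norm (p t - y)) \<le> ereal (inner (p t - y) (u t - v))" for t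
    using \<phi>(4) mem by (fastforce simp: op_graph_def)
  fix e :: real assume e: "0 < e"
  have pos: "0 < \<phi> e" using \<phi>(1,3) e by (auto simp: less_le)
  have "((\<lambda>t. ereal (inner (p t - y) (u t - v))) \<longlongrightarrow> ereal 0) F" using lim by (rule tendsto_ereal)
  then have "\<forall>\<^sub>F t in F. ereal (inner (p t - y) (u t - v)) < \<phi> e"
    using pos by (intro order_tendstoD) (auto simp: zero_ereal_def)
  then show "\<forall>\<^sub>F t in F. dist (p t) y < e"
  proof eventually_elim
    case (elim t)
    have "\<phi> (norm (p t - y)) < \<phi> e" using \<phi>_le elim by (rule le_less_trans)
    then have "\<not> e \<le> norm (p t - y)"
      using \<phi>(2) e by (auto simp: mono_on_def not_le[symmetric])
    then show ?case by (simp add: dist_norm)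
  qed
qed

theorem theorem12:
  fixes A :: "'a::{real_inner, complete_space} set_operator"
    and B :: "'a \<Rightarrow> 'a"
    and \<beta> \<gamma> \<delta> :: real
    and lam :: "real \<Rightarrow> real"
    and x0 :: 'a
    and x :: "real \<Rightarrow> 'a"
  assumes "maximally_monotone_op A"
    and "\<beta> > 0"
    and "cocoercive \<beta> B"
    and "op_zer (op_add A (op_of_fun B)) \<noteq> {}"
    and "0 < \<gamma>" and "\<gamma> < 2 * \<beta>"
    and "\<delta> = min 1 (\<beta> / \<gamma>) + 1 / 2"
    and "lam \<in> borel_measurable (lebesgue_on {0..})"
    and "\<And>t. t \<ge> 0 \<Longrightarrow> 0 \<le> lam t \<and> lam t \<le> \<delta>"
    and "(\<integral>\<^sup>+t. ennreal (lam t * (\<delta> - lam t)) \<partial>lebesgue_on {0..}) = \<infinity>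
         \<or> (INF t\<in>{0..}. lam t) > 0"
    and "strong_global_solution
           (\<lambda>t z. lam t *\<^sub>R (resolvent (op_scaleR \<gamma> A) (z - \<gamma> *\<^sub>R B z) - z)) x0 x"
  shows
    "(bounded (x ` {0..}) \<and>
      integrable (lebesgue_on {0..}) (\<lambda>t. (norm (vector_derivative x (at t within {0..})))\<^sup>2))
   \<and> ((\<lambda>t. resolvent (op_scaleR \<gamma> A) (x t - \<gamma> *\<^sub>R B (x t)) - x t) \<longlongrightarrow> 0) at_top
   \<and> ((\<lambda>t. vector_derivative x (at t within {0..})) \<longlongrightarrow> 0)
        (inf at_top (principal {t. t \<ge> 0 \<and> x differentiable (at t within {0..})}))
   \<and> (\<exists>p \<in> op_zer (op_add A (op_of_fun B)). weakly_tendsto x p at_top)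
   \<and> ((INF t\<in>{0..}. lam t) > 0 \<longrightarrow>
        ((\<forall>y \<in> op_zer (op_add A (op_of_fun B)). ((\<lambda>t. B (x t)) \<longlongrightarrow> B y) at_top) \<and>
         (\<forall>y \<in> op_zer (op_add A (op_of_fun B)). \<forall>z \<in> op_zer (op_add A (op_of_fun B)). B y = B z))
      \<and> (uniformly_monotone_op A \<or> uniformly_monotone_op (op_of_fun B) \<longrightarrow>
           (\<exists>p. op_zer (op_add A (op_of_fun B)) = {p} \<and> (x \<longlongrightarrow> p) at_top)))"
proof -
  note A = assms(1) and \<beta> = assms(2) and B = assms(3) and \<gamma> = assms(5) and lam = assms(9)
  define T where "T = (\<lambda>z. resolvent (op_scaleR \<gamma> A) (z - \<gamma> *\<^sub>R B z))"
  let ?Z = "op_zer (op_add A (op_of_fun B))"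
  have mono: "monotone_op A" using A by (simp add: maximally_monotone_op_def)
  have nonexp: "norm (T u - T v) \<le> norm (u - v)" for u v
    unfolding T_def
    by (rule order_trans[OF resolvent_nonexpansive[OF A \<gamma>] cocoercive_forward_step_nonexpansive[OF B \<gamma> less_imp_le[OF assms(6)]]])
  interpret nonexpansive_flow T lam \<delta> x
    using assms(8,9,11) nonexp
    by unfold_locales (auto simp: strong_global_solution_def T_def)
  have Z_fix: "y \<in> ?Z \<longleftrightarrow> T y = y" for y unfolding T_def by (rule zer_iff_fixpoint(1)[OF A \<gamma>])
  obtain y0 where y0: "T y0 = y0" using assms(4) Z_fix by blast
  have \<delta>: "0 < \<delta>" using assms(7) divide_pos_pos[OF \<beta> \<gamma>] by simp
  \<comment> \<open>In the first alternative the integrand is at most \<delta> \<open>lam t\<close>;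
    in the second \<open>lam\<close> stays above a positive constant on a half-line of infinite
    measure.\<close>
  have inf_lam: "(\<integral>\<^sup>+t. ennreal (lam t) \<partial>lebesgue_on {0..}) = \<infinity>"
    using assms(10)
  proof
    assume inf: "(\<integral>\<^sup>+t. ennreal (lam t * (\<delta> - lam t)) \<partial>lebesgue_on {0..}) = \<infinity>"
    have "(\<integral>\<^sup>+t. ennreal (lam t * (\<delta> - lam t)) \<partial>lebesgue_on {0..}) \<le> (\<integral>\<^sup>+t. ennreal \<delta> * ennreal (lam t) \<partial>lebesgue_on {0..})"
    proof (rule nn_integral_mono)
      fix t :: real assume "t \<in> space (lebesgue_on {0..})"
      then have t: "0 \<le> lam t" using lam[of t] by simp
      then have "lam t * (\<delta> - lam t) \<le> \<delta> * lam t" by (simp add: algebra_simps)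
      then show "ennreal (lam t * (\<delta> - lam t)) \<le> ennreal \<delta> * ennreal (lam t)"
        using t \<delta> by (simp add: ennreal_mult[symmetric] ennreal_leI)
    qed
    also have "\<dots> = ennreal \<delta> * (\<integral>\<^sup>+t. ennreal (lam t) \<partial>lebesgue_on {0..})"
      using assms(8) by (intro nn_integral_cmult) simp
    finally show ?thesis
      unfolding inf by (auto simp: top_unique ennreal_mult_eq_top_iff)
  next
    assume pos: "(INF t\<in>{0..}. lam t) > 0"
    define c where "c = (INF t\<in>{0..}. lam t)"
    have "c \<le> lam t" if "0 \<le> t" for t
      unfolding c_def using that lam by (intro cINF_lower bdd_belowI[of _ 0]) auto
    then have "(\<integral>\<^sup>+t. ennreal c \<partial>lebesgue_on {0::real..}) \<le> (\<integral>\<^sup>+t. ennreal (lam t) \<partial>lebesgue_on {0..})"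
      by (intro nn_integral_mono ennreal_leI) auto
    moreover have "emeasure (lebesgue_on {0..}) {0::real..} = \<infinity>"
      by (subst emeasure_restrict_space) (auto simp: emeasure_lborel_half_line)
    then have "(\<integral>\<^sup>+t. ennreal c \<partial>lebesgue_on {0::real..}) = \<infinity>"
      using pos by (simp add: c_def[symmetric] ennreal_mult_top)
    ultimately show ?thesis by (simp add: top_unique)
  qed
  have res: "(residual \<longlongrightarrow> 0) at_top" by (rule residual_tendsto_0[OF y0 inf_lam])
  have res_lim: "((\<lambda>t. T (x t) - x t) \<longlongrightarrow> 0) at_top"
    using res unfolding residual_def[abs_def] by (rule tendsto_norm_zero_cancel)
  have bdd: "bounded (x ` {0..})"
    unfolding bounded_iff using bounded_trajectory[OF y0] by blast
  have TA: "(1 / \<gamma>) *\<^sub>R (z - \<gamma> *\<^sub>R B z - T z) \<in> A (T z)" for z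
    using resolvent_eq_iff[OF A \<gamma>, of "z - \<gamma> *\<^sub>R B z" "T z"] by (simp add: T_def)
  have strong: "((\<lambda>t. B (x t)) \<longlongrightarrow> B y) at_top"
    "uniformly_monotone_op A \<or> uniformly_monotone_op (op_of_fun B) \<Longrightarrow> (x \<longlongrightarrow> y) at_top" if y: "y \<in> ?Z" for y
  proof -
    have Ty: "T y = y" and By: "- B y \<in> A y" using y Z_fix zer_iff_fixpoint(2)[OF A \<gamma>] by blast+
    define M where "M = norm (x 0 - y)"
    have xM: "norm (x t - y) \<le> M" if "0 \<le> t" for t
      unfolding M_def using norm_diff_fixpoint_antimono[OF Ty _ that] by simp
    have TM: "norm (T (x t) - y) \<le> M" if "0 \<le> t" for t
      using nonexpansive[of "x t" y] xM[OF that] by (simp add: Ty)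
    \<comment> \<open>Cocoercivity and Cauchy-Schwarz make \<open>B\<close> Lipschitz with constant
      1 / \<beta>, so \<open>B (x t)\<close> stays within a bounded distance of
      \<open>B y\<close>.\<close>
    have BM: "\<beta> * norm (B (x t) - B y) \<le> M" if "0 \<le> t" for t
    proof -
      have "\<beta> * (norm (B (x t) - B y))\<^sup>2 \<le> inner (x t - y) (B (x t) - B y)"
        using B by (simp add: cocoercive_def)
      also have "\<dots> \<le> norm (x t - y) * norm (B (x t) - B y)" by (rule norm_cauchy_schwarz)
      also have "\<dots> \<le> M * norm (B (x t) - B y)" by (intro mult_right_mono xM that) simp
      finally have "norm (B (x t) - B y) * (\<beta> * norm (B (x t) - B y)) \<le> norm (B (x t) - B y) * M"
        by (simp add: power2_eq_square algebra_simps)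
      moreover have "0 \<le> M" by (simp add: M_def)
      ultimately show ?thesis by (cases "B (x t) = B y") auto
    qed
    define u where "u = (\<lambda>t. (1 / \<gamma>) *\<^sub>R (x t - \<gamma> *\<^sub>R B (x t) - T (x t)))"
    \<comment> \<open>Here \<open>u t + B y\<close> is -(T x - x) / \<gamma> - (B x - B y).
      Splitting \<open>T x - y\<close> as \<open>(T x - x) + (x - y)\<close> in the second pairing
      isolates two terms with the vanishing factor \<open>T x - x\<close> and one term with a
      sign.\<close>
    have gap: "inner (T (x t) - y) (u t - (- B y)) =
        - inner (T (x t) - y) (T (x t) - x t) / \<gamma> - inner (T (x t) - x t) (B (x t) - B y)
        - inner (x t - y) (B (x t) - B y)" for t
      using \<gamma> by (simp add: u_def inner_diff_left inner_diff_right inner_add_left inner_add_right field_simps)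
    have error: "((\<lambda>t. - inner (T (x t) - y) (T (x t) - x t) / \<gamma> - inner (T (x t) - x t) (B (x t) - B y)) \<longlongrightarrow> 0) at_top"
    proof (rule Lim_null_comparison)
      have "((\<lambda>t. M * residual t / \<gamma> + residual t * (M / \<beta>)) \<longlongrightarrow> M * 0 / \<gamma> + 0 * (M / \<beta>)) at_top"
        using \<gamma> by (intro tendsto_intros res) auto
      then show "((\<lambda>t. M * residual t / \<gamma> + residual t * (M / \<beta>)) \<longlongrightarrow> 0) at_top" by simp
      show "\<forall>\<^sub>F t in at_top. norm (- inner (T (x t) - y) (T (x t) - x t) / \<gamma> - inner (T (x t) - x t) (B (x t) - B y))
          \<le> M * residual t / \<gamma> + residual t * (M / \<beta>)"
        using eventually_ge_at_top[of 0]
      proof eventually_elim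
        case (elim t)
        have "\<bar>inner (T (x t) - y) (T (x t) - x t)\<bar> \<le> M * residual t"
          unfolding residual_def
          by (rule order_trans[OF Cauchy_Schwarz_ineq2 mult_right_mono[OF TM[OF elim] norm_ge_zero]])
        moreover have "\<bar>inner (T (x t) - x t) (B (x t) - B y)\<bar> \<le> residual t * (M / \<beta>)"
        proof -
          have "norm (B (x t) - B y) \<le> M / \<beta>" using BM[OF elim] \<beta> by (simp add: field_simps)
          then show ?thesis
            unfolding residual_def
            by (intro order_trans[OF Cauchy_Schwarz_ineq2] mult_left_mono) simp_all
        qed
        ultimately show ?case
          using \<gamma> abs_triangle_ineq4[of "- inner (T (x t) - y) (T (x t) - x t) / \<gamma>" "inner (T (x t) - x t) (B (x t) - B y)"]
            divide_right_mono[of "\<bar>inner (T (x t) - y) (T (x t) - x t)\<bar>" "M * residual t" \<gamma>]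
          by (simp add: abs_divide)
      qed
    qed
    have gap_nonneg: "0 \<le> inner (T (x t) - y) (u t - (- B y))" for t
      unfolding u_def by (rule monotone_opD[OF mono TA By])
    have inner_nonneg: "0 \<le> \<beta> * (norm (B (x t) - B y))\<^sup>2"
      "\<beta> * (norm (B (x t) - B y))\<^sup>2 \<le> inner (x t - y) (B (x t) - B y)" for t
      using B \<beta> by (simp_all add: cocoercive_def)
    \<comment> \<open>The monotonicity gap of \<open>A\<close> and the pairing with \<open>B\<close>
      are both nonnegative and add up to the vanishing error, so each tends to 0.\<close>
    have inner_lim: "((\<lambda>t. inner (x t - y) (B (x t) - B y)) \<longlongrightarrow> 0) at_top"
    proof (rule tendsto_sandwich[OF _ _ tendsto_const error])
      show "\<forall>\<^sub>F t in at_top. 0 \<le> inner (x t - y) (B (x t) - B y)"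
        by (intro always_eventually allI order_trans[OF inner_nonneg])
      show "\<forall>\<^sub>F t in at_top. inner (x t - y) (B (x t) - B y)
          \<le> - inner (T (x t) - y) (T (x t) - x t) / \<gamma> - inner (T (x t) - x t) (B (x t) - B y)"
        using gap_nonneg unfolding gap by (intro always_eventually allI) simp
    qed
    show "((\<lambda>t. B (x t)) \<longlongrightarrow> B y) at_top"
    proof -
      have "((\<lambda>t. \<beta> * (norm (B (x t) - B y))\<^sup>2) \<longlongrightarrow> 0) at_top"
        by (rule tendsto_sandwich[OF _ _ tendsto_const inner_lim]) (use inner_nonneg in \<open>auto intro!: always_eventually\<close>)
      from tendsto_divide[OF this tendsto_const[of \<beta>]]
      have "((\<lambda>t. (norm (B (x t) - B y))\<^sup>2) \<longlongrightarrow> 0) at_top" using \<beta> by simp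
      from tendsto_real_sqrt[OF this] have "((\<lambda>t. norm (B (x t) - B y)) \<longlongrightarrow> 0) at_top" by simp
      then show ?thesis by (simp add: tendsto_norm_zero_iff LIM_zero_iff)
    qed
    show "(x \<longlongrightarrow> y) at_top" if "uniformly_monotone_op A \<or> uniformly_monotone_op (op_of_fun B)"
      using that
    proof
      assume UA: "uniformly_monotone_op A"
      \<comment> \<open>Uniform monotonicity of \<open>A\<close> acts at the graph point over
        \<open>T (x t)\<close>, not over \<open>x t\<close>; the vanishing residual then carries the
        limit back to \<open>x\<close>.\<close>
      have "((\<lambda>t. inner (T (x t) - y) (u t - (- B y))) \<longlongrightarrow> 0) at_top"
        unfolding gap using tendsto_diff[OF error inner_lim] by simp
      then have "((\<lambda>t. T (x t)) \<longlongrightarrow> y) at_top"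
        by (intro uniformly_monotone_tendsto[OF UA _ By]) (simp_all add: u_def TA)
      from tendsto_diff[OF this res_lim] show ?thesis by simp
    next
      assume UB: "uniformly_monotone_op (op_of_fun B)"
      show ?thesis
        by (rule uniformly_monotone_tendsto[OF UB _ _ inner_lim]) (simp_all add: op_of_fun_def)
    qed
  qed
  \<comment> \<open>Every zero provides a limit of the same curve \<open>B (x t)\<close>, and limits
    are unique. Uniqueness of the zero follows below in the same way from the limit of
    \<open>x\<close>.\<close>
  have "\<forall>y\<in>?Z. \<forall>z\<in>?Z. B y = B z"
    by (intro ballI) (rule tendsto_unique[OF trivial_limit_at_top_linorder strong(1) strong(1)])
  moreover have "\<exists>p. ?Z = {p} \<and> (x \<longlongrightarrow> p) at_top"
    if um: "uniformly_monotone_op A \<or> uniformly_monotone_op (op_of_fun B)"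
  proof -
    have y0Z: "y0 \<in> ?Z" using y0 Z_fix by simp
    have "y = y0" if "y \<in> ?Z" for y
      by (rule tendsto_unique[OF trivial_limit_at_top_linorder strong(2)[OF that um] strong(2)[OF y0Z um]])
    with y0Z have "?Z = {y0}" by blast
    with strong(2)[OF y0Z um] show ?thesis by blast
  qed
  moreover have "\<exists>p\<in>?Z. weakly_tendsto x p at_top"
    using weakly_convergent_to_fixpoint[OF y0 res] unfolding Z_fix bex_simps Bex_def by blast
  ultimately show ?thesis
    using derivative_square_integrable[OF y0] derivative_tendsto_0[OF res] bdd strong(1) res_lim[unfolded T_def]
    by (intro conjI impI ballI) (assumption | blast)+
qed

end
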